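(* Let $n,N\ge2$ and let $\{u_h\}\subset BV(B^n;\mathbb R^N)$ be a sequence converging weakly-$*$ in $BV$ to some $u\in BV(B^n;\mathbb R^N)$, and assume that $\mathcal V(u_h,B^n)\to\mathcal V(u,B^n)$ as $h\to\infty$. Then $$\lim_{h\to\infty}\left(\int_{B^n}|\nabla u_h-\nabla u|\,dx+|D^su_h|(B^n)\right)=|D^su|(B^n),$$ and hence $\{u_h\}$ converges to $u$ strictly in $BV$.
   Context: $B^n$ is the open unit ball of $\mathbb R^n$. For $u\in BV(B^n;\mathbb R^N)$, $Du=\nabla u\,\mathcal L^n+D^su$ is the decomposition of the distributional derivative into absolutely continuous part (with density the approximate gradient $\nabla u$) and singular part $D^su$; $|\cdot|(B^n)$ denotes total variation, and $$\mathcal V(u,B^n)=\int_{B^n}\sqrt{1+|\nabla u|^2}\,dx+|D^su|(B^n).$$ $u_h\to u$ weakly-$*$ in $BV$ means $u_h\to u$ strongly in $L^1(B^n;\mathbb R^N)$ and $Du_h\rightharpoonup Du$ weakly-$*$ as measures; it converges strictly in $BV$ if in addition $|Du_h|(B^n)\to|Du|(B^n)$. *)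

theory Defs
  imports "HOL-Analysis.Analysis"
begin

section \<open>Finite vector-valued measures\<close>

text \<open>A finite vector measure is a countably additive set function on \<open>sets M\<close>. Its values outside
  \<open>sets M\<close> are irrelevant. Taking all sets empty gives \<open>\<mu> {} = 0\<close>.\<close>

definition vector_measure :: "'a measure \<Rightarrow> ('a set \<Rightarrow> 'b::euclidean_space) \<Rightarrow> bool" where
  "vector_measure M \<mu> \<longleftrightarrow>
    (\<forall>A::nat \<Rightarrow> 'a set. range A \<subseteq> sets M \<longrightarrow> disjoint_family A \<longrightarrow>
      (\<lambda>i. \<mu> (A i)) sums \<mu> (\<Union>i. A i))"

definition total_variation :: "'a measure \<Rightarrow> ('a set \<Rightarrow> 'b::euclidean_space) \<Rightarrow> 'a set \<Rightarrow> ennreal" where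
  "total_variation M \<mu> A =
    (SUP E \<in> {E::nat \<Rightarrow> 'a set. range E \<subseteq> sets M \<and> disjoint_family E \<and> (\<Union>i. E i) = A}.
      \<Sum>i. ennreal (norm (\<mu> (E i))))"

text \<open>The positive part \<open>(\<bar>\<mu>\<bar> + \<mu>) / 2\<close> of a real (signed) measure. The negative part of
  \<open>\<mu>\<close> is the positive part of \<open>-\<mu>\<close>.\<close>

definition positive_part :: "'a measure \<Rightarrow> ('a set \<Rightarrow> real) \<Rightarrow> 'a measure" where
  "positive_part M \<mu> =
    measure_of (space M) (sets M) (\<lambda>A. ennreal ((enn2real (total_variation M \<mu> A) + \<mu> A) / 2))"

definition signed_integral :: "'a measure \<Rightarrow> ('a set \<Rightarrow> real) \<Rightarrow> ('a \<Rightarrow> real) \<Rightarrow> real" where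
  "signed_integral M \<mu> \<phi> =
    (\<integral>x. \<phi> x \<partial>positive_part M \<mu>) - (\<integral>x. \<phi> x \<partial>positive_part M (\<lambda>A. - \<mu> A))"

definition vector_integral ::
  "'a measure \<Rightarrow> ('a set \<Rightarrow> 'b::euclidean_space) \<Rightarrow> ('a \<Rightarrow> real) \<Rightarrow> 'b" where
  "vector_integral M \<mu> \<phi> = (\<Sum>b\<in>Basis. signed_integral M (\<lambda>A. \<mu> A \<bullet> b) \<phi> *\<^sub>R b)"

abbreviation borel_on :: "'a::topological_space set \<Rightarrow> 'a measure" where
  "borel_on \<Omega> \<equiv> restrict_space borel \<Omega>"

text \<open>\<open>\<mu>\<close> is concentrated on a Lebesgue null Borel set.\<close>

definition lebesgue_singular ::
  "'a::euclidean_space set \<Rightarrow> ('a set \<Rightarrow> 'b::euclidean_space) \<Rightarrow> bool" where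
  "lebesgue_singular \<Omega> \<mu> \<longleftrightarrow>
    (\<exists>S\<in>sets (borel_on \<Omega>). emeasure lborel S = 0 \<and> total_variation (borel_on \<Omega>) \<mu> (\<Omega> - S) = 0)"

definition C0 :: "'a::topological_space set \<Rightarrow> ('a \<Rightarrow> real) set" where
  "C0 \<Omega> = {\<phi>. continuous_on \<Omega> \<phi> \<and> (\<forall>e>0. compact {x\<in>\<Omega>. e \<le> \<bar>\<phi> x\<bar>})}"

definition weak_star_measures ::
  "'a::euclidean_space set \<Rightarrow> (nat \<Rightarrow> 'a set \<Rightarrow> 'b::euclidean_space) \<Rightarrow> ('a set \<Rightarrow> 'b) \<Rightarrow> bool" where
  "weak_star_measures \<Omega> \<mu>s \<mu> \<longleftrightarrow>
    (\<forall>\<phi>\<in>C0 \<Omega>. (\<lambda>h. vector_integral (borel_on \<Omega>) (\<mu>s h) \<phi>)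
      \<longlonglongrightarrow> vector_integral (borel_on \<Omega>) \<mu> \<phi>)"

section \<open>Test functions\<close>

definition partial_deriv :: "'n \<Rightarrow> (real^'n \<Rightarrow> real) \<Rightarrow> real^'n \<Rightarrow> real" where
  "partial_deriv j \<phi> x = frechet_derivative \<phi> (at x) (axis j 1)"

fun Ck :: "nat \<Rightarrow> (real^'n \<Rightarrow> real) \<Rightarrow> bool" where
  "Ck 0 \<phi> \<longleftrightarrow> continuous_on UNIV \<phi>"
| "Ck (Suc k) \<phi> \<longleftrightarrow> (\<forall>x. \<phi> differentiable (at x)) \<and> (\<forall>j. Ck k (partial_deriv j \<phi>))"

text \<open>Test functions are extended by zero to the whole space.\<close>

definition test_functions :: "(real^'n) set \<Rightarrow> (real^'n \<Rightarrow> real) set" where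
  "test_functions \<Omega> = {\<phi>. (\<forall>k. Ck k \<phi>) \<and>
     compact (closure {x. \<phi> x \<noteq> 0}) \<and> closure {x. \<phi> x \<noteq> 0} \<subseteq> \<Omega>}"

section \<open>Functions of bounded variation\<close>

text \<open>Matrices in \<open>real^'n^'m\<close> have rows indexed by the components of \<open>u\<close>. Their \<open>norm\<close> is the
  Euclidean (Frobenius) norm.\<close>

definition is_distributional_derivative ::
  "(real^'n) set \<Rightarrow> (real^'n \<Rightarrow> real^'m) \<Rightarrow> ((real^'n) set \<Rightarrow> real^'n^'m) \<Rightarrow> bool" where
  "is_distributional_derivative \<Omega> u \<mu> \<longleftrightarrow> vector_measure (borel_on \<Omega>) \<mu> \<and>
    (\<forall>\<phi>\<in>test_functions \<Omega>. \<forall>i j.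
      (LINT x:\<Omega>|lebesgue. u x $ i * partial_deriv j \<phi> x)
        = - (vector_integral (borel_on \<Omega>) \<mu> \<phi> $ i $ j))"

definition BV :: "(real^'n) set \<Rightarrow> (real^'n \<Rightarrow> real^'m) set" where
  "BV \<Omega> = {u. set_integrable lebesgue \<Omega> u \<and> (\<exists>\<mu>. is_distributional_derivative \<Omega> u \<mu>)}"

text \<open>For open \<open>\<Omega>\<close> and \<open>u \<in> BV \<Omega>\<close>, the chosen measure is unique on the Borel subsets of \<open>\<Omega>\<close>.\<close>

definition distr_deriv ::
  "(real^'n) set \<Rightarrow> (real^'n \<Rightarrow> real^'m) \<Rightarrow> (real^'n) set \<Rightarrow> real^'n^'m" where
  "distr_deriv \<Omega> u = (SOME \<mu>. is_distributional_derivative \<Omega> u \<mu>)"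

text \<open>The approximate gradient is the density of the absolutely continuous part in the Lebesgue
  decomposition of the distributional derivative. It is unique almost everywhere in \<open>\<Omega>\<close>.\<close>

definition approx_gradient ::
  "(real^'n) set \<Rightarrow> (real^'n \<Rightarrow> real^'m) \<Rightarrow> real^'n \<Rightarrow> real^'n^'m" where
  "approx_gradient \<Omega> u = (SOME g. set_integrable lebesgue \<Omega> g \<and>
     lebesgue_singular \<Omega> (\<lambda>A. distr_deriv \<Omega> u A - (LINT x:A|lebesgue. g x)))"

definition singular_part ::
  "(real^'n) set \<Rightarrow> (real^'n \<Rightarrow> real^'m) \<Rightarrow> (real^'n) set \<Rightarrow> real^'n^'m" where
  "singular_part \<Omega> u A = distr_deriv \<Omega> u A - (LINT x:A|lebesgue. approx_gradient \<Omega> u x)"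

definition calV :: "(real^'n) set \<Rightarrow> (real^'n \<Rightarrow> real^'m) \<Rightarrow> ennreal" where
  "calV \<Omega> u =
    (\<integral>\<^sup>+x\<in>\<Omega>. ennreal (sqrt (1 + (norm (approx_gradient \<Omega> u x))\<^sup>2)) \<partial>lebesgue)
      + total_variation (borel_on \<Omega>) (singular_part \<Omega> u) \<Omega>"

definition BV_weak_star ::
  "(real^'n) set \<Rightarrow> (nat \<Rightarrow> real^'n \<Rightarrow> real^'m) \<Rightarrow> (real^'n \<Rightarrow> real^'m) \<Rightarrow> bool" where
  "BV_weak_star \<Omega> us u \<longleftrightarrow>
    (\<lambda>h. \<integral>\<^sup>+x\<in>\<Omega>. ennreal (norm (us h x - u x)) \<partial>lebesgue) \<longlonglongrightarrow> 0 \<and>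
    weak_star_measures \<Omega> (\<lambda>h. distr_deriv \<Omega> (us h)) (distr_deriv \<Omega> u)"

definition BV_strict ::
  "(real^'n) set \<Rightarrow> (nat \<Rightarrow> real^'n \<Rightarrow> real^'m) \<Rightarrow> (real^'n \<Rightarrow> real^'m) \<Rightarrow> bool" where
  "BV_strict \<Omega> us u \<longleftrightarrow> BV_weak_star \<Omega> us u \<and>
    (\<lambda>h. total_variation (borel_on \<Omega>) (distr_deriv \<Omega> (us h)) \<Omega>)
      \<longlonglongrightarrow> total_variation (borel_on \<Omega>) (distr_deriv \<Omega> u) \<Omega>"

end

theory Submission
  imports Defs
begin

text \<open>
  The area \<open>\<V>(v)\<close> is the total variation of the vector measure \<open>(\<L>, Dv)\<close> with values in
  \<open>\<real> \<times> \<real>\<^sup>N\<^sup>\<times>\<^sup>n\<close>, where \<open>\<L>\<close> is Lebesgue measure. The assumptions therefore say that these measures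
  converge weakly-* together with their total masses, and the theorem is an instance of Reshetnyak's
  continuity theorem: under such convergence, integrals of a continuous positively 1-homogeneous
  integrand of the density also converge. The integrands used are
  \<open>\<Phi>(x, t, p) = \<bar>p - t G(x)\<bar>\<close> for a continuous \<open>G\<close> with compact support. Since \<open>Dv\<close> has density
  \<open>\<nabla>v\<close> with respect to \<open>\<L>\<close> where \<open>\<L>\<close> lives, and \<open>\<L>\<close> vanishes where \<open>D\<^sup>sv\<close> lives, the
  corresponding functional is \<open>\<integral>\<bar>\<nabla>v - G\<bar> + \<bar>D\<^sup>sv\<bar>(B)\<close>. Letting \<open>G\<close> approach \<open>\<nabla>u\<close> in \<open>L\<^sup>1\<close> yields the
  limit, and \<open>G = 0\<close> yields strict convergence.

  For these integrands Reshetnyak's theorem has a short direct proof, \<open>graph_excess_continuous\<close>.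
  The lower bound is duality: a vector measure is nearly normed by a continuous compactly supported
  field (\<open>Cc_norming\<close>). For the upper bound, \<open>\<Phi>\<close> is approximated by \<open>\<bar>A\<^sub>x(t, p)\<bar>\<close> with the invertible
  linear map \<open>A\<^sub>x(t, p) = (\<epsilon>t, p - tG(x))\<close>. By \<open>norm_linear_le_tangent\<close>, this norm exceeds its
  linearisation in a direction \<open>w\<close> by at most a constant times \<open>\<bar>z\<bar> - w \<bullet> z\<close>. If \<open>W(x)\<close> is a
  continuous field close to the direction of the limit measure, then all terms of the resulting upper
  bound are either linear in the measure or its total mass, so they pass to the limit, where
  \<open>\<integral>(\<bar>z\<bar> - W \<bullet> z)\<close> is small.

  All measures that belong to one function \<open>v\<close> are written as densities with respect to a common
  finite measure (\<open>ex_graph_density\<close>), which turns total variations, pairings with test functions,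
  and the Lebesgue decomposition of \<open>Dv\<close> into statements about integrable functions. This
  needs that a finite vector measure is dominated by a finite positive measure
  (\<open>vector_measure_bounded\<close>, \<open>ex_upper_variation\<close>) and the formula
  \<open>\<bar>p\<Lambda>\<bar> = \<bar>p\<bar>\<Lambda>\<close> (\<open>total_variation_density\<close>).
\<close>

section \<open>Vector measures are dominated by finite measures\<close>

lemma vector_measure_sums:
  assumes "vector_measure M \<mu>" "range A \<subseteq> sets M" "disjoint_family A"
  shows "(\<lambda>i. \<mu> (A i)) sums \<mu> (\<Union>i. A i)"
  using assms unfolding vector_measure_def by blast

lemma vector_measure_empty:
  assumes "vector_measure M \<mu>"
  shows "\<mu> {} = 0"
proof -
  have "(\<lambda>i::nat. \<mu> {}) sums \<mu> {}"
    using vector_measure_sums[OF assms, of "\<lambda>_. {}"] by (simp add: disjoint_family_on_def)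
  then have "(\<lambda>i::nat. \<mu> {}) \<longlonglongrightarrow> 0"
    by (intro summable_LIMSEQ_zero) (rule sums_summable)
  then show ?thesis
    by (simp add: LIMSEQ_const_iff)
qed

lemma vector_measure_Un:
  assumes "vector_measure M \<mu>" "A \<in> sets M" "B \<in> sets M" "A \<inter> B = {}"
  shows "\<mu> (A \<union> B) = \<mu> A + \<mu> B"
proof -
  have "disjoint_family (binaryset A B)"
    using assms(4) by (auto simp: disjoint_family_on_def binaryset_def)
  moreover have "range (binaryset A B) \<subseteq> sets M"
    using assms by (auto simp: range_binaryset_eq)
  ultimately have "(\<lambda>i. \<mu> (binaryset A B i)) sums \<mu> (A \<union> B)"
    using vector_measure_sums[OF assms(1), of "binaryset A B"] by (simp add: UN_binaryset_eq)
  moreover have "(\<lambda>i. \<mu> (binaryset A B i)) sums (\<mu> A + \<mu> B)"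
    by (rule binaryset_sums) (rule vector_measure_empty[OF assms(1)])
  ultimately show ?thesis
    using sums_unique2 by blast
qed

lemma vector_measure_Diff:
  assumes "vector_measure M \<mu>" "A \<in> sets M" "B \<in> sets M" "B \<subseteq> A"
  shows "\<mu> (A - B) = \<mu> A - \<mu> B"
proof -
  have "\<mu> (B \<union> (A - B)) = \<mu> B + \<mu> (A - B)"
    using assms by (intro vector_measure_Un) auto
  moreover have "B \<union> (A - B) = A" using assms by auto
  ultimately show ?thesis by simp
qed

lemma vector_measure_inner:
  assumes "vector_measure M \<mu>"
  shows "vector_measure M (\<lambda>A. \<mu> A \<bullet> b)"
  using assms unfolding vector_measure_def
  by (auto intro: bounded_linear.sums[OF bounded_linear_inner_left])

text \<open>If a set has subsets of arbitrarily large measure, split off one whose measure is large compared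
  with the whole. Then both pieces have measure of norm at least 1, and one of them again has
  subsets of arbitrarily large measure. Iterating on that piece leaves behind disjoint sets whose measures
  do not tend to 0, against countable additivity.\<close>

lemma vector_measure_bounded:
  fixes \<mu> :: "'a set \<Rightarrow> 'b::euclidean_space"
  assumes \<mu>: "vector_measure M \<mu>"
  shows "\<exists>C. \<forall>E\<in>sets M. norm (\<mu> E) \<le> C"
proof (rule ccontr)
  assume unbounded: "\<not> ?thesis"
  define bad where "bad X \<longleftrightarrow> X \<in> sets M \<and> (\<forall>C. \<exists>E\<in>sets M. E \<subseteq> X \<and> norm (\<mu> E) > C)" for X
  have step: "\<exists>Y. bad Y \<and> Y \<subseteq> X \<and> norm (\<mu> (X - Y)) \<ge> 1" if X: "bad X" for X
  proof -
    obtain E where E: "E \<in> sets M" "E \<subseteq> X" "norm (\<mu> E) > norm (\<mu> X) + 1"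
      using X unfolding bad_def by blast
    have XM: "X \<in> sets M" using X by (simp add: bad_def)
    have XE: "\<mu> (X - E) = \<mu> X - \<mu> E"
      using vector_measure_Diff[OF \<mu> XM E(1) E(2)] .
    have large: "norm (\<mu> (X - E)) \<ge> 1" "norm (\<mu> E) \<ge> 1"
      using E(3) norm_triangle_ineq2[of "\<mu> E" "\<mu> X"] norm_ge_zero[of "\<mu> X"]
      unfolding XE norm_minus_commute[of "\<mu> X" "\<mu> E"] by linarith+
    have "bad E \<or> bad (X - E)"
    proof (rule ccontr)
      assume "\<not> ?thesis"
      then have "\<not> bad E" "\<not> bad (X - E)" by auto
      then obtain C D where C: "\<forall>F\<in>sets M. F \<subseteq> E \<longrightarrow> norm (\<mu> F) \<le> C"
        and D: "\<forall>F\<in>sets M. F \<subseteq> X - E \<longrightarrow> norm (\<mu> F) \<le> D"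
        using E(1) sets.Diff[OF XM E(1)] unfolding bad_def not_less[symmetric] by metis
      have "norm (\<mu> F) \<le> C + D" if F: "F \<in> sets M" "F \<subseteq> X" for F
      proof -
        have "F = (F \<inter> E) \<union> (F - E)" by auto
        moreover have "\<mu> ((F \<inter> E) \<union> (F - E)) = \<mu> (F \<inter> E) + \<mu> (F - E)"
          using F E by (intro vector_measure_Un[OF \<mu>]) auto
        ultimately have "\<mu> F = \<mu> (F \<inter> E) + \<mu> (F - E)" by simp
        moreover have "norm (\<mu> (F \<inter> E)) \<le> C" "norm (\<mu> (F - E)) \<le> D"
          using F E by (auto intro!: C[rule_format] D[rule_format])
        ultimately show ?thesis
          using norm_triangle_ineq[of "\<mu> (F \<inter> E)" "\<mu> (F - E)"] by simp
      qed
      then show False using X unfolding bad_def by (meson not_less)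
    qed
    then show ?thesis
    proof
      assume "bad E"
      then show ?thesis using large E by (intro exI[of _ E]) auto
    next
      assume *: "bad (X - E)"
      have "X - (X - E) = E" using E by auto
      then show ?thesis using large * by (intro exI[of _ "X - E"]) auto
    qed
  qed
  have "bad (space M)"
    unfolding bad_def
  proof (intro conjI allI)
    fix C
    obtain E where "E \<in> sets M" "norm (\<mu> E) > C" using unbounded by (auto simp: not_le)
    then show "\<exists>E\<in>sets M. E \<subseteq> space M \<and> C < norm (\<mu> E)"
      using sets.sets_into_space by blast
  qed simp
  then have "\<exists>X. \<forall>n::nat. bad (X n) \<and> X (Suc n) \<subseteq> X n \<and> norm (\<mu> (X n - X (Suc n))) \<ge> 1"
    using step by (intro dependent_nat_choice) blast+
  then obtain X where X: "\<And>n. bad (X n)" "\<And>n. X (Suc n) \<subseteq> X n"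
      "\<And>n. norm (\<mu> (X n - X (Suc n))) \<ge> 1"
    by blast
  define D where "D n = X n - X (Suc n)" for n
  have "decseq X" by (rule decseq_SucI) (rule X)
  have "disjoint_family D"
  proof -
    have "D i \<inter> D j = {}" if "i < j" for i j
    proof -
      have "X j \<subseteq> X (Suc i)" using \<open>decseq X\<close> that by (auto simp: decseq_def Suc_le_eq)
      then show ?thesis by (auto simp: D_def)
    qed
    then show ?thesis unfolding disjoint_family_on_def by (metis inf_commute linorder_neqE_nat)
  qed
  moreover have "range D \<subseteq> sets M" using X by (auto simp: D_def bad_def)
  ultimately have "(\<lambda>i. \<mu> (D i)) \<longlonglongrightarrow> 0"
    by (intro summable_LIMSEQ_zero sums_summable[OF vector_measure_sums[OF \<mu>]])
  then have "(\<lambda>i. norm (\<mu> (D i))) \<longlonglongrightarrow> 0" by (rule tendsto_norm_zero)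
  then have "(1::real) \<le> 0"
    using X(3) by (intro LIMSEQ_le_const) (auto simp: D_def)
  then show False by simp
qed

lemma ex_measure_countably_additive:
  fixes f :: "'a set \<Rightarrow> ennreal"
  assumes "f {} = 0"
    and "\<And>A. range A \<subseteq> sets M \<Longrightarrow> disjoint_family A \<Longrightarrow> (\<Sum>i. f (A i)) = f (\<Union>i. A i)"
  shows "\<exists>D. sets D = sets M \<and> (\<forall>A\<in>sets M. emeasure D A = f A)"
proof (intro exI conjI ballI)
  let ?D = "measure_of (space M) (sets M) f"
  show "sets ?D = sets M" by simp
  fix A assume "A \<in> sets M"
  then show "emeasure ?D A = f A"
    using assms
    by (intro emeasure_measure_of_sigma)
       (auto simp: sets.sigma_algebra_axioms positive_def countably_additive_def)
qed

lemma ex_sum_measure: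
  assumes "finite I" and "\<And>i. i \<in> I \<Longrightarrow> sets (N i) = sets M"
  shows "\<exists>D. sets D = sets M \<and> (\<forall>A\<in>sets M. emeasure D A = (\<Sum>i\<in>I. emeasure (N i) A))"
proof (rule ex_measure_countably_additive)
  fix A :: "nat \<Rightarrow> _" assume A: "range A \<subseteq> sets M" "disjoint_family A"
  have "(\<Sum>n. \<Sum>i\<in>I. emeasure (N i) (A n)) = (\<Sum>i\<in>I. \<Sum>n. emeasure (N i) (A n))"
    by (rule suminf_sum) simp
  also have "\<dots> = (\<Sum>i\<in>I. emeasure (N i) (\<Union>n. A n))"
    using assms A by (intro sum.cong refl suminf_emeasure) auto
  finally show "(\<Sum>n. \<Sum>i\<in>I. emeasure (N i) (A n)) = (\<Sum>i\<in>I. emeasure (N i) (\<Union>n. A n))" .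
qed simp

text \<open>The measure is the upper variation \<open>sup {\<mu> E | E \<subseteq> A}\<close>. It inherits countable additivity from
  \<open>\<mu>\<close> by cutting and joining the competitors \<open>E\<close>, and it is finite because \<open>\<mu>\<close> is bounded.\<close>

lemma ex_upper_variation:
  fixes \<mu> :: "'a set \<Rightarrow> real"
  assumes \<mu>: "vector_measure M \<mu>"
  shows "\<exists>D. finite_measure D \<and> sets D = sets M \<and> (\<forall>A\<in>sets M. \<mu> A \<le> measure D A)"
proof -
  define p where "p A = (SUP E\<in>{E\<in>sets M. E \<subseteq> A}. ennreal (\<mu> E))" for A
  have p_upper: "ennreal (\<mu> E) \<le> p A" if "E \<in> sets M" "E \<subseteq> A" for E A
    unfolding p_def using that by (intro SUP_upper) auto
  have p_mono: "p A \<le> p A'" if "A \<subseteq> A'" for A A'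
    unfolding p_def using that by (intro SUP_subset_mono) auto
  have p_Un: "p A + p A' \<le> p (A \<union> A')" if "A \<inter> A' = {}" for A A'
  proof -
    have "ennreal (\<mu> E) + ennreal (\<mu> F) \<le> p (A \<union> A')"
      if E: "E \<in> sets M" "E \<subseteq> A" and F: "F \<in> sets M" "F \<subseteq> A'" for E F
    \<comment> \<open>A negative value is truncated to 0 in \<open>ennreal\<close>, so the other set alone is a competitor.\<close>
    proof (cases "\<mu> E \<le> 0 \<or> \<mu> F \<le> 0")
      case True
      then show ?thesis
        using p_upper[of E "A \<union> A'"] p_upper[of F "A \<union> A'"] E F
        by (auto simp: ennreal_neg le_supI1 le_supI2)
    next
      case False
      have "\<mu> (E \<union> F) = \<mu> E + \<mu> F"
        using E F \<open>A \<inter> A' = {}\<close> by (intro vector_measure_Un[OF \<mu>]) auto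
      then have "ennreal (\<mu> E) + ennreal (\<mu> F) = ennreal (\<mu> (E \<union> F))"
        using False by (simp add: ennreal_plus)
      also have "\<dots> \<le> p (A \<union> A')" using E F by (intro p_upper) auto
      finally show ?thesis .
    qed
    then have "ennreal (\<mu> E) + p A' \<le> p (A \<union> A')" if "E \<in> sets M" "E \<subseteq> A" for E
      unfolding p_def[of A'] using that by (subst ennreal_SUP_add_right) (auto intro!: SUP_least)
    then show ?thesis
      unfolding p_def[of A] by (subst ennreal_SUP_add_left[symmetric]) (auto intro!: SUP_least)
  qed
  have p_finite_sum: "(\<Sum>i<n. p (A i)) \<le> p (\<Union>i<n. A i)"
    if "disjoint_family A" for A :: "nat \<Rightarrow> 'a set" and n
  proof (induction n)
    case 0
    show ?case by simp
  next
    case (Suc n)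
    have "(\<Union>i<n. A i) \<inter> A n = {}"
      using disjoint_family_onD[OF that UNIV_I UNIV_I, of _ n] by (blast dest: less_imp_neq)
    have "(\<Sum>i<Suc n. p (A i)) \<le> p (\<Union>i<n. A i) + p (A n)"
      unfolding sum.lessThan_Suc by (rule add_right_mono) (rule Suc)
    also have "\<dots> \<le> p ((\<Union>i<n. A i) \<union> A n)" by (rule p_Un) fact
    also have "(\<Union>i<n. A i) \<union> A n = (\<Union>i<Suc n. A i)" by (auto simp: lessThan_Suc)
    finally show ?case .
  qed
  have "\<exists>D. sets D = sets M \<and> (\<forall>A\<in>sets M. emeasure D A = p A)"
  proof (rule ex_measure_countably_additive)
    have "{E \<in> sets M. E \<subseteq> {}} = {{}}" by auto
    then show "p {} = 0" by (simp add: p_def vector_measure_empty[OF \<mu>])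
    fix A :: "nat \<Rightarrow> 'a set" assume A: "range A \<subseteq> sets M" "disjoint_family A"
    show "(\<Sum>i. p (A i)) = p (\<Union>i. A i)"
    proof (rule antisym)
      have "(\<Sum>i<n. p (A i)) \<le> p (\<Union>i. A i)" for n
        using p_finite_sum[OF A(2), of n] p_mono[of "\<Union>i<n. A i" "\<Union>i. A i"]
        by (meson UN_mono lessThan_iff order_trans subset_UNIV order_refl)
      then show "(\<Sum>i. p (A i)) \<le> p (\<Union>i. A i)"
        by (simp add: suminf_eq_SUP SUP_least)
      have "ennreal (\<mu> E) \<le> (\<Sum>i. p (A i))" if E: "E \<in> sets M" "E \<subseteq> (\<Union>i. A i)" for E
      proof -
        have "(\<lambda>i. \<mu> (E \<inter> A i)) sums \<mu> (\<Union>i. E \<inter> A i)"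
          using A E by (intro vector_measure_sums[OF \<mu>]) (auto simp: disjoint_family_on_def)
        moreover have "(\<Union>i. E \<inter> A i) = E" using E by auto
        ultimately have "(\<lambda>n. \<Sum>i<n. \<mu> (E \<inter> A i)) \<longlonglongrightarrow> \<mu> E" by (simp add: sums_def)
        then have "(\<lambda>n. ennreal (\<Sum>i<n. \<mu> (E \<inter> A i))) \<longlonglongrightarrow> ennreal (\<mu> E)" by simp
        moreover have "ennreal (\<Sum>i<n. \<mu> (E \<inter> A i)) \<le> (\<Sum>i. p (A i))" for n
        proof -
          have "ennreal (\<Sum>i<n. \<mu> (E \<inter> A i)) \<le> ennreal (\<Sum>i<n. max 0 (\<mu> (E \<inter> A i)))"
            by (intro ennreal_leI sum_mono) auto
          also have "\<dots> = (\<Sum>i<n. ennreal (max 0 (\<mu> (E \<inter> A i))))"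
            by (subst sum_ennreal) auto
          also have "\<dots> = (\<Sum>i<n. ennreal (\<mu> (E \<inter> A i)))"
            by (intro sum.cong refl) (auto simp: max_def ennreal_neg)
          also have "\<dots> \<le> (\<Sum>i<n. p (A i))"
            using A E by (intro sum_mono p_upper) auto
          also have "\<dots> \<le> (\<Sum>i. p (A i))"
            by (intro sum_le_suminf) auto
          finally show ?thesis .
        qed
        ultimately show ?thesis by (intro LIMSEQ_le_const2[of _ "ennreal (\<mu> E)"]) auto
      qed
      then show "p (\<Union>i. A i) \<le> (\<Sum>i. p (A i))"
        unfolding p_def[of "\<Union>i. A i"] by (intro SUP_least) auto
    qed
  qed
  then obtain D where D: "sets D = sets M" "\<And>A. A \<in> sets M \<Longrightarrow> emeasure D A = p A" by auto
  obtain C where C: "\<And>E. E \<in> sets M \<Longrightarrow> norm (\<mu> E) \<le> C"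
    using vector_measure_bounded[OF \<mu>] by auto
  have "p A \<le> ennreal C" for A
    unfolding p_def using C by (intro SUP_least ennreal_leI) (force simp: abs_le_iff)
  then have fin: "finite_measure D"
    using D sets_eq_imp_space_eq[OF D(1)]
    by (intro finite_measureI) (metis ennreal_less_top infinity_ennreal_def leD sets.top)
  moreover have "\<mu> A \<le> measure D A" if A: "A \<in> sets M" for A
  proof -
    have "ennreal (\<mu> A) \<le> ennreal (measure D A)"
      using p_upper[of A A] D(2)[OF A] A finite_measure.emeasure_eq_measure[OF fin] by simp
    then show ?thesis by (simp add: ennreal_le_iff)
  qed
  ultimately show ?thesis using D by blast
qed

text \<open>\<open>\<Lambda>\<close> is the sum of \<open>N\<close> and the upper variations of \<open>\<mu>\<close> in all coordinate directions and their
  opposites. It dominates each \<open>\<bar>\<mu> \<bullet> b\<bar>\<close>, so Radon-Nikodym applies to the positive measures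
  \<open>\<mu> \<bullet> b + \<Lambda>\<close>; subtracting 1 from their densities gives those of \<open>\<mu> \<bullet> b\<close>.\<close>

lemma ex_common_density:
  fixes \<mu> :: "'a set \<Rightarrow> 'b::euclidean_space"
  assumes \<mu>: "vector_measure M \<mu>" and N: "finite_measure N" "sets N = sets M"
  obtains \<Lambda> \<tau> p where "finite_measure \<Lambda>" "sets \<Lambda> = sets M"
    "\<tau> \<in> borel_measurable \<Lambda>" "\<And>x. 0 \<le> \<tau> x" "N = density \<Lambda> (\<lambda>x. ennreal (\<tau> x))"
    "integrable \<Lambda> p" "\<And>A. A \<in> sets M \<Longrightarrow> \<mu> A = (LINT x:A|\<Lambda>. p x)"
proof -
  define I where "I = (Basis \<union> uminus ` Basis :: 'b set)"
  have "finite I" by (simp add: I_def)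
  have "\<exists>D. finite_measure D \<and> sets D = sets M \<and> (\<forall>A\<in>sets M. \<mu> A \<bullet> c \<le> measure D A)" for c
    by (rule ex_upper_variation[OF vector_measure_inner[OF \<mu>]])
  then obtain D where D: "\<And>c. finite_measure (D c)" "\<And>c. sets (D c) = sets M"
    "\<And>c A. A \<in> sets M \<Longrightarrow> \<mu> A \<bullet> c \<le> measure (D c) A"
    by metis
  obtain S where S: "sets S = sets M" "\<And>A. A \<in> sets M \<Longrightarrow> emeasure S A = (\<Sum>c\<in>I. emeasure (D c) A)"
    using ex_sum_measure[OF \<open>finite I\<close>, of D M] D by blast
  obtain \<Lambda> where \<Lambda>: "sets \<Lambda> = sets M"
    "\<And>A. A \<in> sets M \<Longrightarrow> emeasure \<Lambda> A = emeasure N A + (\<Sum>c\<in>I. emeasure (D c) A)"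
  proof -
    have "sets (if b then N else S) = sets M" for b using S N by simp
    then show thesis
      using ex_sum_measure[of "{True, False}" "\<lambda>b. if b then N else S" M] S(2) that by auto
  qed
  have spc: "space \<Lambda> = space M" by (rule sets_eq_imp_space_eq[OF \<Lambda>(1)])
  have fin: "finite_measure \<Lambda>"
  proof
    show "emeasure \<Lambda> (space \<Lambda>) \<noteq> \<infinity>"
      using \<Lambda>(2)[of "space M"] D(1) N(1) \<open>finite I\<close>
      by (simp add: spc finite_measure.emeasure_finite)
  qed
  interpret \<Lambda>: finite_measure \<Lambda> by (rule fin)
  have "absolutely_continuous \<Lambda> N"
    using \<Lambda> N by (auto simp: absolutely_continuous_def null_sets_def)
  then obtain t where t: "t \<in> borel_measurable \<Lambda>" "density \<Lambda> t = N"
    using \<Lambda>.Radon_Nikodym_finite_measure[OF N(1)] N(2) \<Lambda>(1) by auto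
  have "AE x in \<Lambda>. t x \<noteq> \<infinity>"
  proof -
    have "(\<integral>\<^sup>+x. t x \<partial>\<Lambda>) = emeasure N (space \<Lambda>)"
      unfolding t(2)[symmetric] using t(1) by (subst emeasure_density) (auto intro!: nn_integral_cong)
    then have "(\<integral>\<^sup>+x. t x \<partial>\<Lambda>) \<noteq> \<infinity>"
      using N(1) by (simp add: finite_measure.emeasure_finite)
    then show ?thesis using t(1) by (intro nn_integral_noteq_infinite) auto
  qed
  then have N_eq: "N = density \<Lambda> (\<lambda>x. ennreal (enn2real (t x)))"
    unfolding t(2)[symmetric] using t(1)
    by (intro density_cong) (auto simp: less_top)
  have component: "\<exists>q. integrable \<Lambda> q \<and> (\<forall>A\<in>sets M. \<mu> A \<bullet> b = (LINT x:A|\<Lambda>. q x))" if b: "b \<in> Basis" for b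
  proof -
    have bound: "\<bar>\<mu> A \<bullet> b\<bar> \<le> measure \<Lambda> A" if A: "A \<in> sets M" for A
    proof -
      have "measure (D c) A \<le> measure \<Lambda> A" if "c \<in> I" for c
      proof -
        have "emeasure (D c) A \<le> (\<Sum>c\<in>I. emeasure (D c) A)"
          using \<open>finite I\<close> that by (intro member_le_sum) auto
        also have "\<dots> \<le> emeasure \<Lambda> A" using \<Lambda>(2)[OF A] by simp
        finally show ?thesis
          by (simp add: finite_measure.emeasure_eq_measure[OF D(1)] \<Lambda>.emeasure_eq_measure)
      qed
      moreover have "b \<in> I" "- b \<in> I" using b by (auto simp: I_def)
      ultimately have "\<mu> A \<bullet> b \<le> measure \<Lambda> A" "\<mu> A \<bullet> (- b) \<le> measure \<Lambda> A"
        using D(3)[OF A] order_trans by blast+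
      then show ?thesis by simp
    qed
    have "\<exists>J. sets J = sets M \<and> (\<forall>A\<in>sets M. emeasure J A = ennreal (\<mu> A \<bullet> b + measure \<Lambda> A))"
    proof (rule ex_measure_countably_additive)
      show "ennreal (\<mu> {} \<bullet> b + measure \<Lambda> {}) = 0" by (simp add: vector_measure_empty[OF \<mu>])
      fix A :: "nat \<Rightarrow> 'a set" assume A: "range A \<subseteq> sets M" "disjoint_family A"
      have "(\<lambda>i. \<mu> (A i) \<bullet> b + measure \<Lambda> (A i)) sums (\<mu> (\<Union>i. A i) \<bullet> b + measure \<Lambda> (\<Union>i. A i))"
        using A \<Lambda>(1)
        by (intro sums_add vector_measure_sums[OF vector_measure_inner[OF \<mu>]] \<Lambda>.finite_measure_UNION) auto
      moreover have "0 \<le> \<mu> (A i) \<bullet> b + measure \<Lambda> (A i)" for i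
        using bound[of "A i"] A by (auto simp: abs_le_iff)
      ultimately show "(\<Sum>i. ennreal (\<mu> (A i) \<bullet> b + measure \<Lambda> (A i)))
          = ennreal (\<mu> (\<Union>i. A i) \<bullet> b + measure \<Lambda> (\<Union>i. A i))"
        by (intro suminf_ennreal_eq) auto
    qed
    then obtain J where J: "sets J = sets M"
      "\<And>A. A \<in> sets M \<Longrightarrow> emeasure J A = ennreal (\<mu> A \<bullet> b + measure \<Lambda> A)" by auto
    have finJ: "finite_measure J"
      using J(2)[of "space M"] sets_eq_imp_space_eq[OF J(1)] by (intro finite_measureI) simp
    have "absolutely_continuous \<Lambda> J"
      unfolding absolutely_continuous_def
    proof
      fix A assume "A \<in> null_sets \<Lambda>"
      then have A: "A \<in> sets M" "measure \<Lambda> A = 0"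
        using \<Lambda>(1) by (auto simp: null_sets_def measure_def)
      then show "A \<in> null_sets J"
        using J bound[OF A(1)] by (auto simp: null_sets_def)
    qed
    then obtain j where j: "j \<in> borel_measurable \<Lambda>" "density \<Lambda> j = J"
      using \<Lambda>.Radon_Nikodym_finite_measure[OF finJ] J(1) \<Lambda>(1) by auto
    have nnj: "(\<integral>\<^sup>+x. j x * indicator A x \<partial>\<Lambda>) = ennreal (\<mu> A \<bullet> b + measure \<Lambda> A)" if "A \<in> sets M" for A
      using that J(2)[OF that] \<Lambda>(1) j unfolding j(2)[symmetric] by (subst (asm) emeasure_density) auto
    have "(\<integral>\<^sup>+x. j x \<partial>\<Lambda>) = ennreal (\<mu> (space M) \<bullet> b + measure \<Lambda> (space M))"
      using nnj[OF sets.top] by (simp add: spc[symmetric] cong: nn_integral_cong)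
    then have "AE x in \<Lambda>. j x \<noteq> \<infinity>"
      using j(1) by (intro nn_integral_noteq_infinite) auto
    then have ae: "AE x in \<Lambda>. ennreal (enn2real (j x)) = j x"
      by eventually_elim (simp add: less_top)
    have int: "has_bochner_integral \<Lambda> (\<lambda>x. enn2real (j x) * indicator A x) (\<mu> A \<bullet> b + measure \<Lambda> A)"
      if A: "A \<in> sets M" for A
    proof (rule has_bochner_integral_nn_integral)
      have "(\<integral>\<^sup>+x. ennreal (enn2real (j x) * indicator A x) \<partial>\<Lambda>) = (\<integral>\<^sup>+x. j x * indicator A x \<partial>\<Lambda>)"
        using ae by (intro nn_integral_cong_AE) (auto simp: indicator_def)
      then show "(\<integral>\<^sup>+x. ennreal (enn2real (j x) * indicator A x) \<partial>\<Lambda>) = ennreal (\<mu> A \<bullet> b + measure \<Lambda> A)"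
        using nnj[OF A] by simp
      show "0 \<le> \<mu> A \<bullet> b + measure \<Lambda> A" using bound[OF A] by (auto simp: abs_le_iff)
    qed (use A \<Lambda>(1) j(1) in auto)
    have cmp: "has_bochner_integral \<Lambda> (\<lambda>x. enn2real (j x) * indicator A x - indicator A x) (\<mu> A \<bullet> b)"
      if A: "A \<in> sets M" for A
    proof -
      have "has_bochner_integral \<Lambda> (indicator A) (measure \<Lambda> A)"
        using A \<Lambda>(1) by (intro has_bochner_integral_real_indicator) (auto simp: \<Lambda>.emeasure_finite less_top[symmetric])
      from has_bochner_integral_diff[OF int[OF A] this] show ?thesis by simp
    qed
    let ?q = "\<lambda>x. enn2real (j x) - 1"
    have "integrable \<Lambda> ?q"
    proof -
      have "integrable \<Lambda> (\<lambda>x. enn2real (j x) * indicator (space M) x - indicator (space M) x)"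
        using cmp[OF sets.top] by (rule integrable.intros)
      then show ?thesis by (rule Bochner_Integration.integrable_cong[THEN iffD1, rotated -1]) (auto simp: spc)
    qed
    moreover have "\<mu> A \<bullet> b = (LINT x:A|\<Lambda>. ?q x)" if "A \<in> sets M" for A
      using has_bochner_integral_integral_eq[OF cmp[OF that]]
      by (simp add: set_lebesgue_integral_def algebra_simps)
    ultimately show ?thesis by blast
  qed
  then obtain q where q: "\<And>b. b \<in> Basis \<Longrightarrow> integrable \<Lambda> (q b)"
    "\<And>b A. b \<in> Basis \<Longrightarrow> A \<in> sets M \<Longrightarrow> \<mu> A \<bullet> b = (LINT x:A|\<Lambda>. q b x)"
    by metis
  define p where "p x = (\<Sum>b\<in>Basis. q b x *\<^sub>R b)" for x
  have "integrable \<Lambda> p" unfolding p_def using q by (intro Bochner_Integration.integrable_sum) auto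
  moreover have "\<mu> A = (LINT x:A|\<Lambda>. p x)" if A: "A \<in> sets M" for A
  proof -
    have "integrable \<Lambda> (\<lambda>x. indicator A x * q b x)" if "b \<in> Basis" for b
      using integrable_mult_indicator[OF _ q(1)[OF that], of A] A \<Lambda>(1) by simp
    then have "(LINT x:A|\<Lambda>. p x) = (\<Sum>b\<in>Basis. (LINT x:A|\<Lambda>. q b x) *\<^sub>R b)"
      unfolding p_def set_lebesgue_integral_def
      by (simp add: scaleR_sum_right)
    also have "\<dots> = \<mu> A" using q(2) A by (simp add: euclidean_representation flip: q(2) cong: sum.cong)
    finally show ?thesis by simp
  qed
  ultimately show thesis
    using that[OF fin \<Lambda>(1) _ _ N_eq, of p] t(1) by simp
qed

section \<open>Variation and integrals of a measure with density\<close>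

text \<open>That the variation is at most \<open>\<integral>\<bar>p\<bar>\<close> is the triangle inequality. Conversely, \<open>A\<close> is cut into
  countably many pieces on which the direction of \<open>p\<close> is constant up to \<open>e\<close>; there
  almost no cancellation occurs in \<open>\<integral>p\<close>.\<close>

lemma total_variation_density:
  fixes \<mu> :: "'a set \<Rightarrow> 'b::euclidean_space"
  assumes sets: "sets \<Lambda> = sets M" and p: "integrable \<Lambda> p"
    and \<mu>: "\<And>A. A \<in> sets M \<Longrightarrow> \<mu> A = (LINT x:A|\<Lambda>. p x)"
    and A: "A \<in> sets M"
  shows "total_variation M \<mu> A = (\<integral>\<^sup>+x\<in>A. ennreal (norm (p x)) \<partial>\<Lambda>)"
proof (rule antisym)
  have [measurable]: "p \<in> borel_measurable \<Lambda>" using p by auto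
  have A': "A \<in> sets \<Lambda>" using A sets by simp
  define D where "D = density \<Lambda> (\<lambda>x. ennreal (norm (p x)))"
  have D: "emeasure D E = (\<integral>\<^sup>+x\<in>E. ennreal (norm (p x)) \<partial>\<Lambda>)" if "E \<in> sets M" for E
    unfolding D_def using that sets by (intro emeasure_density) auto
  have sD: "sets D = sets M" by (simp add: D_def sets)
  have D_real: "emeasure D E = ennreal (LINT x:E|\<Lambda>. norm (p x))" if "E \<in> sets M" for E
  proof -
    have "integrable \<Lambda> (\<lambda>x. indicator E x *\<^sub>R norm (p x))"
      using that sets p by (intro integrable_mult_indicator) auto
    then have "(\<integral>\<^sup>+x. ennreal (indicator E x *\<^sub>R norm (p x)) \<partial>\<Lambda>) = ennreal (LINT x:E|\<Lambda>. norm (p x))"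
      unfolding set_lebesgue_integral_def by (intro nn_integral_eq_integral) auto
    moreover have "(\<integral>\<^sup>+x. ennreal (indicator E x *\<^sub>R norm (p x)) \<partial>\<Lambda>) = (\<integral>\<^sup>+x\<in>E. ennreal (norm (p x)) \<partial>\<Lambda>)"
      by (intro nn_integral_cong) (auto simp: indicator_def)
    ultimately show ?thesis using D[OF that] by simp
  qed
  have sipE: "set_integrable \<Lambda> E p" if "E \<in> sets M" for E
    unfolding set_integrable_def using that sets p by (intro integrable_mult_indicator) auto
  show "total_variation M \<mu> A \<le> (\<integral>\<^sup>+x\<in>A. ennreal (norm (p x)) \<partial>\<Lambda>)"
    unfolding total_variation_def
  proof (rule SUP_least)
    fix E assume "E \<in> {E::nat \<Rightarrow> 'a set. range E \<subseteq> sets M \<and> disjoint_family E \<and> (\<Union>i. E i) = A}"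
    then have E: "\<And>i. E i \<in> sets M" "disjoint_family E" "(\<Union>i. E i) = A" by auto
    have "ennreal (norm (\<mu> (E i))) \<le> emeasure D (E i)" for i
      unfolding D_real[OF E(1)] \<mu>[OF E(1)]
      by (intro ennreal_leI set_integral_norm_bound sipE E)
    then have "(\<Sum>i. ennreal (norm (\<mu> (E i)))) \<le> (\<Sum>i. emeasure D (E i))"
      by (intro suminf_le) auto
    also have "\<dots> = emeasure D A"
      using E sD unfolding E(3)[symmetric] by (intro suminf_emeasure) auto
    finally show "(\<Sum>i. ennreal (norm (\<mu> (E i)))) \<le> (\<integral>\<^sup>+x\<in>A. ennreal (norm (p x)) \<partial>\<Lambda>)"
      using D[OF A] by simp
  qed
  have lower: "ennreal (1 - 2 * e) * emeasure D A \<le> total_variation M \<mu> A" if e: "0 < e" "e < 1/2" for e :: real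
  proof -
    obtain V :: "'b set" where V: "countable V" "\<And>X. open X \<Longrightarrow> X \<noteq> {} \<Longrightarrow> \<exists>d\<in>V. d \<in> X"
      using countable_dense_setE[where 'a='b] by metis
    have "V \<noteq> {}" using V(2)[of UNIV] by auto
    define d where "d = from_nat_into V"
    \<comment> \<open>The condition is multiplied by \<open>\<bar>p x\<bar>\<close>, so that the zeros of \<open>p\<close> belong to every piece.\<close>
    define E where "E i = {x\<in>A \<inter> space \<Lambda>. norm (p x - norm (p x) *\<^sub>R d i) \<le> e * norm (p x)}" for i
    have EM: "E i \<in> sets M" for i
    proof -
      have "E i = A \<inter> {x\<in>space \<Lambda>. norm (p x - norm (p x) *\<^sub>R d i) \<le> e * norm (p x)}"
        by (auto simp: E_def)
      also have "\<dots> \<in> sets \<Lambda>"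
        by (intro sets.Int A' borel_measurable_le) measurable
      finally show ?thesis using sets by simp
    qed
    have "A \<subseteq> (\<Union>i. E i)"
    proof
      fix x assume x: "x \<in> A"
      then have xs: "x \<in> space \<Lambda>" using sets.sets_into_space[OF A'] by blast
      show "x \<in> (\<Union>i. E i)"
      proof (cases "p x = 0")
        case True
        then show ?thesis using x xs by (auto simp: E_def)
      next
        case False
        obtain v where "v \<in> V" "v \<in> ball (p x /\<^sub>R norm (p x)) e"
          using V(2)[of "ball (p x /\<^sub>R norm (p x)) e"] e by auto
        then obtain i where i: "norm (p x /\<^sub>R norm (p x) - d i) < e"
          using from_nat_into_surj[OF V(1)] unfolding d_def dist_norm mem_ball by metis
        have "p x - norm (p x) *\<^sub>R d i = norm (p x) *\<^sub>R (p x /\<^sub>R norm (p x) - d i)"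
          using False by (simp add: algebra_simps)
        then have "norm (p x - norm (p x) *\<^sub>R d i) = norm (p x) * norm (p x /\<^sub>R norm (p x) - d i)"
          by simp
        also have "\<dots> \<le> norm (p x) * e" using i by (intro mult_left_mono) auto
        finally show ?thesis using x xs by (auto simp: E_def mult.commute)
      qed
    qed
    then have UE: "(\<Union>i. E i) = A" by (auto simp: E_def)
    define F where "F = disjointed E"
    have F: "disjoint_family F" "(\<Union>i. F i) = A" "\<And>i. F i \<subseteq> E i"
      unfolding F_def by (simp_all add: disjoint_family_disjointed UN_disjointed_eq UE disjointed_subset)
    have FM: "F i \<in> sets M" for i
      using sets.range_disjointed_sets[of E M] EM unfolding F_def by auto
    have each: "ennreal (1 - 2 * e) * emeasure D (F i) \<le> ennreal (norm (\<mu> (F i)))" for i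
    proof -
      let ?I = "LINT x:F i|\<Lambda>. norm (p x)"
      have "(1 - 2 * e) * ?I \<le> norm (\<mu> (F i))"
      proof (cases "\<exists>x\<in>F i. p x \<noteq> 0")
        case False
        then have "?I = 0" unfolding set_lebesgue_integral_def
          by (intro integral_eq_zero_AE) (auto simp: indicator_def)
        then show ?thesis by simp
      next
        case True
        then obtain x where x: "x \<in> F i" "p x \<noteq> 0" by auto
        then have "norm (p x - norm (p x) *\<^sub>R d i) \<le> e * norm (p x)"
          using F(3)[of i] by (auto simp: E_def)
        then have "norm (p x) * (1 - e) \<le> norm (p x) * norm (d i)"
          using norm_triangle_ineq2[of "p x" "norm (p x) *\<^sub>R d i"] by (simp add: algebra_simps)
        then have di: "1 - e \<le> norm (d i)" using x by simp
        have int1: "set_integrable \<Lambda> (F i) (\<lambda>x. norm (p x))"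
          using set_integrable_norm[OF sipE[OF FM]] .
        have int2: "set_integrable \<Lambda> (F i) (\<lambda>x. norm (p x) *\<^sub>R d i)"
          by (intro set_integrable_scaleR_left int1)
        have "(LINT x:F i|\<Lambda>. norm (p x) *\<^sub>R d i) = ?I *\<^sub>R d i"
          using FM sets p by (intro set_integral_scaleR_left) auto
        then have "\<mu> (F i) - ?I *\<^sub>R d i = (LINT x:F i|\<Lambda>. p x - norm (p x) *\<^sub>R d i)"
          unfolding \<mu>[OF FM] using set_integral_diff(2)[OF sipE[OF FM] int2] by simp
        also have "norm \<dots> \<le> (LINT x:F i|\<Lambda>. norm (p x - norm (p x) *\<^sub>R d i))"
          by (intro set_integral_norm_bound set_integral_diff(1) sipE FM int2)
        also have "\<dots> \<le> (LINT x:F i|\<Lambda>. e * norm (p x))"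
          using F(3)[of i]
          by (intro set_integral_mono set_integrable_norm[OF set_integral_diff(1)] sipE FM int2
              set_integrable_mult_right int1) (auto simp: E_def)
        also have "\<dots> = e * ?I" by simp
        finally have "norm (\<mu> (F i) - ?I *\<^sub>R d i) \<le> e * ?I" .
        moreover have I0: "0 \<le> ?I" unfolding set_lebesgue_integral_def by (intro integral_nonneg_AE) auto
        moreover have "norm (?I *\<^sub>R d i) \<le> norm (\<mu> (F i)) + norm (\<mu> (F i) - ?I *\<^sub>R d i)"
          using norm_triangle_ineq4[of "\<mu> (F i)" "\<mu> (F i) - ?I *\<^sub>R d i"] by simp
        moreover have "?I * (1 - e) \<le> ?I * norm (d i)" using di I0 by (rule mult_left_mono)
        ultimately show ?thesis by (simp add: algebra_simps)
      qed
      then show ?thesis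
        unfolding D_real[OF FM] using e by (subst ennreal_mult'[symmetric]) (auto intro: ennreal_leI)
    qed
    have "ennreal (1 - 2 * e) * emeasure D A = (\<Sum>i. ennreal (1 - 2 * e) * emeasure D (F i))"
      using F FM sD unfolding F(2)[symmetric] by (subst suminf_emeasure[symmetric]) auto
    also have "\<dots> \<le> (\<Sum>i. ennreal (norm (\<mu> (F i))))" using each by (intro suminf_le) auto
    also have "\<dots> \<le> total_variation M \<mu> A"
      unfolding total_variation_def using F FM by (intro SUP_upper) auto
    finally show ?thesis .
  qed
  define r where "r = (LINT x:A|\<Lambda>. norm (p x))"
  have Dr: "emeasure D A = ennreal r" unfolding r_def by (rule D_real[OF A])
  have "(\<lambda>n. ennreal ((1 - 2 * (1 / real (n + 3))) * r)) \<longlonglongrightarrow> ennreal ((1 - 2 * 0) * r)"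
    by (intro tendsto_ennrealI tendsto_intros LIMSEQ_ignore_initial_segment[OF lim_1_over_n])
  moreover have "ennreal ((1 - 2 * (1 / real (n + 3))) * r) \<le> total_variation M \<mu> A" for n
    using lower[of "1 / real (n + 3)"] unfolding Dr by (subst ennreal_mult') (auto simp: field_simps)
  ultimately have "ennreal r \<le> total_variation M \<mu> A"
    by (intro LIMSEQ_le_const2[of _ "ennreal r"]) auto
  then show "(\<integral>\<^sup>+x\<in>A. ennreal (norm (p x)) \<partial>\<Lambda>) \<le> total_variation M \<mu> A"
    using D[OF A] Dr by simp
qed

lemma positive_part_density:
  fixes \<mu> :: "'a set \<Rightarrow> real"
  assumes sets: "sets \<Lambda> = sets M" and p: "integrable \<Lambda> p"
    and \<mu>: "\<And>A. A \<in> sets M \<Longrightarrow> \<mu> A = (LINT x:A|\<Lambda>. p x)"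
  shows "positive_part M \<mu> = density \<Lambda> (\<lambda>x. ennreal (max 0 (p x)))"
proof -
  let ?D = "density \<Lambda> (\<lambda>x. ennreal (max 0 (p x)))"
  have [measurable]: "p \<in> borel_measurable \<Lambda>" using p by auto
  have "ennreal ((enn2real (total_variation M \<mu> A) + \<mu> A) / 2) = emeasure ?D A" if A: "A \<in> sets M" for A
  proof -
    have A': "A \<in> sets \<Lambda>" using A sets by simp
    have int: "integrable \<Lambda> (\<lambda>x. indicator A x * p x)"
      using integrable_mult_indicator[OF A' p] by simp
    have int': "integrable \<Lambda> (\<lambda>x. indicator A x * \<bar>p x\<bar>)"
      using integrable_mult_indicator[OF A', of "\<lambda>x. \<bar>p x\<bar>"] p by simp
    have "total_variation M \<mu> A = (\<integral>\<^sup>+x\<in>A. ennreal (norm (p x)) \<partial>\<Lambda>)"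
      by (rule total_variation_density[OF sets p \<mu> A])
    also have "\<dots> = (\<integral>\<^sup>+x. ennreal (indicator A x * \<bar>p x\<bar>) \<partial>\<Lambda>)"
      by (intro nn_integral_cong) (auto simp: indicator_def)
    also have "\<dots> = ennreal (\<integral>x. indicator A x * \<bar>p x\<bar> \<partial>\<Lambda>)"
      using int' by (intro nn_integral_eq_integral) auto
    finally have "enn2real (total_variation M \<mu> A) = (\<integral>x. indicator A x * \<bar>p x\<bar> \<partial>\<Lambda>)"
      by (simp add: integral_nonneg_AE)
    then have "(enn2real (total_variation M \<mu> A) + \<mu> A) / 2
        = (\<integral>x. (indicator A x * \<bar>p x\<bar> + indicator A x * p x) / 2 \<partial>\<Lambda>)"
      using \<mu>[OF A] int int' by (simp add: set_lebesgue_integral_def)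
    also have "ennreal \<dots> = (\<integral>\<^sup>+x. ennreal ((indicator A x * \<bar>p x\<bar> + indicator A x * p x) / 2) \<partial>\<Lambda>)"
      using int int' by (intro nn_integral_eq_integral[symmetric]) (auto simp: indicator_def)
    also have "\<dots> = (\<integral>\<^sup>+x. ennreal (max 0 (p x)) * indicator A x \<partial>\<Lambda>)"
      by (intro nn_integral_cong) (auto simp: indicator_def max_def)
    also have "\<dots> = emeasure ?D A"
      using A' by (intro emeasure_density[symmetric]) auto
    finally show ?thesis .
  qed
  then have "positive_part M \<mu> = measure_of (space M) (sets M) (emeasure ?D)"
    unfolding positive_part_def by (intro measure_of_eq) (auto simp: sets.space_closed sets.sigma_sets_eq)
  also have "\<dots> = measure_of (space ?D) (sets ?D) (emeasure ?D)"
    using sets sets_eq_imp_space_eq[OF sets] by simp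
  also have "\<dots> = ?D" by (rule measure_of_of_measure)
  finally show ?thesis .
qed

lemma vector_integral_density:
  fixes \<mu> :: "'a set \<Rightarrow> 'b::euclidean_space"
  assumes sets: "sets \<Lambda> = sets M" and p: "integrable \<Lambda> p"
    and \<mu>: "\<And>A. A \<in> sets M \<Longrightarrow> \<mu> A = (LINT x:A|\<Lambda>. p x)"
    and \<phi>: "\<phi> \<in> borel_measurable \<Lambda>" "\<And>x. \<bar>\<phi> x\<bar> \<le> C"
  shows "vector_integral M \<mu> \<phi> = (\<integral>x. \<phi> x *\<^sub>R p x \<partial>\<Lambda>)"
proof -
  have bounded_mult: "integrable \<Lambda> (\<lambda>x. q x * \<phi> x)" if "integrable \<Lambda> q" for q :: "'a \<Rightarrow> real"
  proof (rule Bochner_Integration.integrable_bound)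
    show "integrable \<Lambda> (\<lambda>x. C * q x)" using that by simp
    have "\<bar>q x * \<phi> x\<bar> \<le> \<bar>C * q x\<bar>" for x
      using mult_right_mono[OF order_trans[OF \<phi>(2) abs_ge_self], of "\<bar>q x\<bar>" x]
      by (simp add: abs_mult mult.commute)
    then show "AE x in \<Lambda>. norm (q x * \<phi> x) \<le> norm (C * q x)" by simp
  qed (use that \<phi> in auto)
  have signed: "signed_integral M (\<lambda>A. \<mu> A \<bullet> b) \<phi> = (\<integral>x. (p x \<bullet> b) * \<phi> x \<partial>\<Lambda>)" for b
  proof -
    let ?q = "\<lambda>x. p x \<bullet> b"
    have q: "integrable \<Lambda> ?q" using p by simp
    have q': "(\<mu> A) \<bullet> b = (LINT x:A|\<Lambda>. ?q x)" if "A \<in> sets M" for A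
    proof -
      have "integrable \<Lambda> (\<lambda>x. indicator A x *\<^sub>R p x)"
        using that sets p by (intro integrable_mult_indicator) auto
      from integral_inner_left[OF this, of b] show ?thesis
        using \<mu>[OF that] by (simp add: set_lebesgue_integral_def)
    qed
    have minus: "- (\<mu> A \<bullet> b) = (LINT x:A|\<Lambda>. - ?q x)" if "A \<in> sets M" for A
      using q'[OF that] by (simp add: set_lebesgue_integral_def)
    have m: "?q \<in> borel_measurable \<Lambda>" using q by auto
    have "signed_integral M (\<lambda>A. \<mu> A \<bullet> b) \<phi>
        = (\<integral>x. max 0 (?q x) * \<phi> x \<partial>\<Lambda>) - (\<integral>x. max 0 (- ?q x) * \<phi> x \<partial>\<Lambda>)"
      unfolding signed_integral_def
        positive_part_density[OF sets q q', simplified]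
        positive_part_density[OF sets integrable_minus[OF q] minus, simplified]
      using m \<phi> by (subst (1 2) integral_density) auto
    also have "\<dots> = (\<integral>x. max 0 (?q x) * \<phi> x - max 0 (- ?q x) * \<phi> x \<partial>\<Lambda>)"
      using q by (intro Bochner_Integration.integral_diff[symmetric] bounded_mult) auto
    also have "\<dots> = (\<integral>x. ?q x * \<phi> x \<partial>\<Lambda>)"
      by (intro Bochner_Integration.integral_cong refl) (auto simp: max_def)
    finally show ?thesis .
  qed
  have int: "integrable \<Lambda> (\<lambda>x. \<phi> x *\<^sub>R p x)"
  proof (rule Bochner_Integration.integrable_bound)
    show "integrable \<Lambda> (\<lambda>x. norm (p x) * \<phi> x)" using p by (intro bounded_mult) auto
  qed (use p \<phi> in \<open>auto simp: abs_mult\<close>)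
  show ?thesis
  proof (rule euclidean_eqI)
    fix b :: 'b assume b: "b \<in> Basis"
    have "vector_integral M \<mu> \<phi> \<bullet> b = (\<integral>x. (p x \<bullet> b) * \<phi> x \<partial>\<Lambda>)"
      unfolding vector_integral_def signed using b by simp
    also have "\<dots> = (\<integral>x. (\<phi> x *\<^sub>R p x) \<bullet> b \<partial>\<Lambda>)" by (simp add: mult.commute)
    also have "\<dots> = (\<integral>x. \<phi> x *\<^sub>R p x \<partial>\<Lambda>) \<bullet> b"
      by (rule integral_inner_left) (rule int)
    finally show "vector_integral M \<mu> \<phi> \<bullet> b = (\<integral>x. \<phi> x *\<^sub>R p x \<partial>\<Lambda>) \<bullet> b" .
  qed
qed

section \<open>Continuous fields with compact support\<close>

text \<open>The fields are defined on the whole space and vanish outside a compact subset of \<open>\<Omega>\<close>. Requiring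
  continuity everywhere, and not only on \<open>\<Omega>\<close>, makes them bounded Borel functions.\<close>

definition Cc :: "'a::euclidean_space set \<Rightarrow> ('a \<Rightarrow> 'b::real_normed_vector) set" where
  "Cc \<Omega> = {\<sigma>. continuous_on UNIV \<sigma> \<and> (\<exists>K. compact K \<and> K \<subseteq> \<Omega> \<and> (\<forall>x. x \<notin> K \<longrightarrow> \<sigma> x = 0))}"

lemma CcI:
  assumes "continuous_on UNIV \<sigma>" "compact K" "K \<subseteq> \<Omega>" "\<And>x. x \<notin> K \<Longrightarrow> \<sigma> x = 0"
  shows "\<sigma> \<in> Cc \<Omega>"
  using assms unfolding Cc_def by blast

lemma Cc_continuous: "\<sigma> \<in> Cc \<Omega> \<Longrightarrow> continuous_on UNIV \<sigma>"
  by (simp add: Cc_def)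

lemma Cc_zero: "(\<lambda>_. 0) \<in> Cc \<Omega>"
  by (rule CcI[of _ "{}"]) auto

lemma Cc_add:
  assumes "\<sigma> \<in> Cc \<Omega>" "\<tau> \<in> Cc \<Omega>"
  shows "(\<lambda>x. \<sigma> x + \<tau> x) \<in> Cc \<Omega>"
proof -
  obtain K where K: "compact K" "K \<subseteq> \<Omega>" "\<And>x. x \<notin> K \<Longrightarrow> \<sigma> x = 0"
    using assms(1) unfolding Cc_def by blast
  obtain L where L: "compact L" "L \<subseteq> \<Omega>" "\<And>x. x \<notin> L \<Longrightarrow> \<tau> x = 0"
    using assms(2) unfolding Cc_def by blast
  show ?thesis
  proof (rule CcI)
    show "continuous_on UNIV (\<lambda>x. \<sigma> x + \<tau> x)"
      by (intro continuous_on_add Cc_continuous[OF assms(1)] Cc_continuous[OF assms(2)])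
    show "compact (K \<union> L)" "K \<union> L \<subseteq> \<Omega>" using K L by auto
    show "\<sigma> x + \<tau> x = 0" if "x \<notin> K \<union> L" for x using K(3)[of x] L(3)[of x] that by simp
  qed
qed

text \<open>The support only shrinks under pointwise operations that preserve zero.\<close>

lemma Cc_support:
  assumes "\<sigma> \<in> Cc \<Omega>" "continuous_on UNIV \<tau>" "\<And>x. \<sigma> x = 0 \<Longrightarrow> \<tau> x = 0"
  shows "\<tau> \<in> Cc \<Omega>"
proof -
  obtain K where K: "compact K" "K \<subseteq> \<Omega>" "\<And>x. x \<notin> K \<Longrightarrow> \<sigma> x = 0"
    using assms(1) unfolding Cc_def by blast
  show ?thesis by (rule CcI[OF assms(2) K(1,2) assms(3)[OF K(3)]])
qed

lemma Cc_bounded: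
  assumes "\<sigma> \<in> Cc \<Omega>"
  obtains C where "0 \<le> C" "\<And>x. norm (\<sigma> x) \<le> C"
proof -
  obtain K where K: "compact K" "K \<subseteq> \<Omega>" "\<And>x. x \<notin> K \<Longrightarrow> \<sigma> x = 0" using assms unfolding Cc_def by blast
  have "compact (\<sigma> ` K)"
    using K(1) Cc_continuous[OF assms] continuous_on_subset by (intro compact_continuous_image) auto
  then obtain C where C: "\<And>y. y \<in> \<sigma> ` K \<Longrightarrow> norm y \<le> C"
    using compact_imp_bounded bounded_iff by metis
  show thesis
  proof (rule that[of "max 0 C"])
    show "norm (\<sigma> x) \<le> max 0 C" for x
      using C[of "\<sigma> x"] K(3)[of x] by (cases "x \<in> K") (auto simp: le_max_iff_disj)
  qed simp
qed

lemma Cc_measurable: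
  assumes "\<sigma> \<in> Cc \<Omega>" "sets \<Lambda> = sets (borel_on \<Omega>)"
  shows "\<sigma> \<in> borel_measurable \<Lambda>"
proof -
  have "\<sigma> \<in> borel_measurable (borel_on \<Omega>)"
    by (intro measurable_restrict_space1 borel_measurable_continuous_onI Cc_continuous[OF assms(1)])
  then show ?thesis by (simp cong: measurable_cong_sets add: assms(2))
qed

lemma Cc_integrable:
  fixes \<sigma> :: "'a::euclidean_space \<Rightarrow> 'b::{banach, second_countable_topology}"
  assumes "\<sigma> \<in> Cc \<Omega>" "finite_measure \<Lambda>" "sets \<Lambda> = sets (borel_on \<Omega>)"
  shows "integrable \<Lambda> \<sigma>"
proof -
  obtain C where C: "\<And>x. norm (\<sigma> x) \<le> C" using Cc_bounded[OF assms(1)] by blast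
  then show ?thesis
    by (intro finite_measure.integrable_const_bound[OF assms(2), of _ C] Cc_measurable[OF assms(1,3)]) auto
qed

lemma Cc_inner_integrable:
  fixes \<sigma> q :: "'a::euclidean_space \<Rightarrow> 'b::euclidean_space"
  assumes "\<sigma> \<in> Cc \<Omega>" "sets \<Lambda> = sets (borel_on \<Omega>)" "integrable \<Lambda> q"
  shows "integrable \<Lambda> (\<lambda>x. \<sigma> x \<bullet> q x)"
proof -
  obtain C where C: "\<And>x. norm (\<sigma> x) \<le> C" using Cc_bounded[OF assms(1)] by blast
  have [measurable]: "\<sigma> \<in> borel_measurable \<Lambda>" "q \<in> borel_measurable \<Lambda>"
    using Cc_measurable[OF assms(1,2)] assms(3) by auto
  show ?thesis
  proof (rule Bochner_Integration.integrable_bound)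
    show "integrable \<Lambda> (\<lambda>x. C * norm (q x))" using assms by simp
    have "\<bar>\<sigma> x \<bullet> q x\<bar> \<le> C * norm (q x)" for x
      using order_trans[OF Cauchy_Schwarz_ineq2 mult_right_mono[OF C[of x] norm_ge_zero]] .
    then have "norm (\<sigma> x \<bullet> q x) \<le> norm (C * norm (q x))" for x
      by (metis abs_ge_self order_trans real_norm_def)
    then show "AE x in \<Lambda>. norm (\<sigma> x \<bullet> q x) \<le> norm (C * norm (q x))" by simp
  qed simp
qed

lemma Cc_scaleR_integrable:
  fixes \<sigma> :: "'a::euclidean_space \<Rightarrow> 'b::{banach, second_countable_topology}" and q :: "'a \<Rightarrow> real"
  assumes "\<sigma> \<in> Cc \<Omega>" "sets \<Lambda> = sets (borel_on \<Omega>)" "integrable \<Lambda> q"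
  shows "integrable \<Lambda> (\<lambda>x. q x *\<^sub>R \<sigma> x)"
proof -
  obtain C where C: "0 \<le> C" "\<And>x. norm (\<sigma> x) \<le> C" using Cc_bounded[OF assms(1)] by blast
  have [measurable]: "\<sigma> \<in> borel_measurable \<Lambda>" "q \<in> borel_measurable \<Lambda>"
    using Cc_measurable[OF assms(1,2)] assms(3) by auto
  show ?thesis
  proof (rule Bochner_Integration.integrable_bound)
    show "integrable \<Lambda> (\<lambda>x. C * q x)" using assms by simp
    show "AE x in \<Lambda>. norm (q x *\<^sub>R \<sigma> x) \<le> norm (C * q x)"
      using C by (auto simp: abs_mult mult.commute[of C] intro!: mult_left_mono)
  qed simp
qed

lemma ex_compact_inner:
  fixes \<Omega> :: "'a::euclidean_space set"
  assumes \<Omega>: "open \<Omega>" and \<Lambda>: "finite_measure \<Lambda>" "sets \<Lambda> = sets (borel_on \<Omega>)"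
    and A: "A \<in> sets \<Lambda>" and e: "e > 0"
  shows "\<exists>K. compact K \<and> K \<subseteq> A \<and> measure \<Lambda> A < measure \<Lambda> K + e"
proof (rule ccontr)
  interpret finite_measure \<Lambda> by (rule \<Lambda>)
  have sp: "space \<Lambda> = \<Omega>"
    using sets_eq_imp_space_eq[OF \<Lambda>(2)] by (simp add: space_restrict_space)
  have Ab: "A \<in> sets borel" "A \<subseteq> \<Omega>"
    using A \<Omega> unfolding \<Lambda>(2) by (auto simp: sets_restrict_space_iff)
  define N where "N = distr \<Lambda> borel (\<lambda>x. x)"
  have id: "(\<lambda>x. x) \<in> measurable \<Lambda> borel"
    using \<Lambda>(2) by (simp cong: measurable_cong_sets add: measurable_restrict_space1)
  have N: "emeasure N B = emeasure \<Lambda> B" if "B \<in> sets borel" "B \<subseteq> \<Omega>" for B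
    unfolding N_def using that by (subst emeasure_distr[OF id]) (auto simp: sp Int_absorb2)
  assume no: "\<nexists>K. compact K \<and> K \<subseteq> A \<and> measure \<Lambda> A < measure \<Lambda> K + e"
  have *: "measure \<Lambda> K \<le> measure \<Lambda> A - e" if "compact K" "K \<subseteq> A" for K
  proof -
    have "\<not> measure \<Lambda> A < measure \<Lambda> K + e" using no that by blast
    then show ?thesis by simp
  qed
  have "finite_measure N" unfolding N_def by (rule finite_measure_distr[OF id])
  then have "emeasure N A = (SUP K\<in>{K. K \<subseteq> A \<and> compact K}. emeasure N K)"
    using Ab by (intro inner_regular) (auto simp: N_def finite_measure.emeasure_finite)
  also have "\<dots> \<le> ennreal (measure \<Lambda> A - e)"
  proof (rule SUP_least)
    fix K assume "K \<in> {K. K \<subseteq> A \<and> compact K}"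
    then have K: "K \<subseteq> A" "compact K" by auto
    then have "emeasure N K = ennreal (measure \<Lambda> K)"
      using Ab by (subst N) (auto simp: emeasure_eq_measure compact_imp_closed)
    then show "emeasure N K \<le> ennreal (measure \<Lambda> A - e)"
      using *[OF K(2,1)] by (simp add: ennreal_leI)
  qed
  finally have "ennreal (measure \<Lambda> A) \<le> ennreal (measure \<Lambda> A - e)"
    using N[OF Ab] by (simp add: emeasure_eq_measure)
  moreover have "0 \<le> measure \<Lambda> A - e" using *[of "{}"] by simp
  ultimately show False using e by (simp add: ennreal_le_iff)
qed

text \<open>The functions \<open>max 0 (1 - n \<cdot> infdist x K)\<close> decrease to the indicator of \<open>K\<close>, and their supports
  lie in \<open>\<Omega>\<close> for large \<open>n\<close>.\<close>

lemma Cc_dense_indicator_compact: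
  fixes \<Omega> :: "'a::euclidean_space set"
  assumes \<Omega>: "open \<Omega>" and \<Lambda>: "finite_measure \<Lambda>" "sets \<Lambda> = sets (borel_on \<Omega>)"
    and K: "compact K" "K \<subseteq> \<Omega>" and e: "e > 0"
  shows "\<exists>\<phi>\<in>Cc \<Omega>. (\<integral>x. \<bar>indicator K x - \<phi> x\<bar> \<partial>\<Lambda>) < (e::real)"
proof (cases "K = {}")
  case True
  then show ?thesis using e by (intro bexI[OF _ Cc_zero]) simp
next
  case False
  interpret finite_measure \<Lambda> by (rule \<Lambda>)
  define \<phi> where "\<phi> n x = max 0 (1 - real n * infdist x K)" for n x
  have cont: "continuous_on UNIV (\<phi> n)" for n
    unfolding \<phi>_def by (intro continuous_intros)
  have [measurable]: "\<phi> n \<in> borel_measurable \<Lambda>" for n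
    using borel_measurable_continuous_onI[OF cont, of n] measurable_restrict_space1 \<Lambda>(2)
    by (metis measurable_cong_sets)
  have [measurable]: "K \<in> sets \<Lambda>"
    using K \<Omega> unfolding \<Lambda>(2) by (auto simp: sets_restrict_space_iff compact_imp_closed)
  have "(\<lambda>n. \<integral>x. \<bar>indicator K x - \<phi> n x\<bar> \<partial>\<Lambda>) \<longlonglongrightarrow> (\<integral>x. 0 \<partial>\<Lambda>)"
  proof (rule integral_dominated_convergence[where w="\<lambda>_. 1"])
    have "(\<lambda>n. \<bar>indicator K x - \<phi> n x\<bar>) \<longlonglongrightarrow> 0" for x
    proof (cases "x \<in> K")
      case True
      then show ?thesis by (simp add: \<phi>_def)
    next
      case nK: False
      then have "infdist x K > 0"
        using in_closed_iff_infdist_zero[OF compact_imp_closed[OF K(1)] False] infdist_nonneg[of x K]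
        by (metis order_le_less)
      then obtain m where m: "1 < real m * infdist x K" using reals_Archimedean3 by blast
      have "\<bar>indicator K x - \<phi> n x\<bar> = 0" if "n \<ge> m" for n
      proof -
        have "real m * infdist x K \<le> real n * infdist x K"
          using that infdist_nonneg by (intro mult_right_mono) auto
        then show ?thesis using m nK by (simp add: \<phi>_def)
      qed
      then have "eventually (\<lambda>n. \<bar>indicator K x - \<phi> n x\<bar> = 0) sequentially"
        using eventually_sequentially by blast
      then show ?thesis by (rule tendsto_eventually)
    qed
    then show "AE x in \<Lambda>. (\<lambda>n. \<bar>indicator K x - \<phi> n x\<bar>) \<longlonglongrightarrow> 0" by simp
    show "AE x in \<Lambda>. norm \<bar>indicator K x - \<phi> n x\<bar> \<le> 1" for n
    proof (rule AE_I2)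
      fix x
      have "0 \<le> real n * infdist x K" by (simp add: infdist_nonneg)
      then show "norm \<bar>indicator K x - \<phi> n x\<bar> \<le> 1" by (auto simp: \<phi>_def indicator_def)
    qed
  qed (auto simp: emeasure_finite less_top[symmetric])
  then have small: "eventually (\<lambda>n. (\<integral>x. \<bar>indicator K x - \<phi> n x\<bar> \<partial>\<Lambda>) < e) sequentially"
    using e by (auto dest: order_tendstoD(2))
  obtain d where d: "d > 0" "{x. infdist x K \<le> d} \<subseteq> \<Omega>"
    using compact_in_open_separated[OF False K(1) \<Omega> K(2)] by blast
  have "eventually (\<lambda>n. (\<integral>x. \<bar>indicator K x - \<phi> n x\<bar> \<partial>\<Lambda>) < e \<and> 1 / real n < d \<and> n > 0) sequentially"
    using small order_tendstoD(2)[OF lim_1_over_n d(1)] eventually_gt_at_top[of 0]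
    by (intro eventually_conj)
  then obtain n where n: "(\<integral>x. \<bar>indicator K x - \<phi> n x\<bar> \<partial>\<Lambda>) < e" "1 / real n < d" "n > 0"
    using eventually_happens'[OF sequentially_bot] by blast
  have "\<phi> n \<in> Cc \<Omega>"
  proof (rule CcI[OF cont])
    show "compact {x. infdist x K \<le> d}" by (rule compact_infdist_le[OF False K(1) d(1)])
    fix x assume "x \<notin> {x. infdist x K \<le> d}"
    then have "1 / real n < infdist x K" using n(2) by simp
    then show "\<phi> n x = 0" using n(3) by (simp add: \<phi>_def field_simps)
  qed fact
  then show ?thesis using n(1) by blast
qed

proposition Cc_dense:
  fixes f :: "'a::euclidean_space \<Rightarrow> 'b::euclidean_space"
  assumes \<Omega>: "open \<Omega>" and \<Lambda>: "finite_measure \<Lambda>" "sets \<Lambda> = sets (borel_on \<Omega>)"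
    and f: "integrable \<Lambda> f" and e: "e > 0"
  shows "\<exists>\<sigma>\<in>Cc \<Omega>. (\<integral>x. norm (f x - \<sigma> x) \<partial>\<Lambda>) < e"
  using f e
proof (induction f arbitrary: e rule: integrable_induct)
  case (base A c e)
  interpret finite_measure \<Lambda> by (rule \<Lambda>)
  have "A \<subseteq> \<Omega>"
    using sets.sets_into_space[OF base(1)] sets_eq_imp_space_eq[OF \<Lambda>(2)] by (simp add: space_restrict_space)
  define d where "d = e / (2 * (1 + norm c))"
  have d: "d > 0" using base by (simp add: d_def add_pos_nonneg)
  obtain K where K: "compact K" "K \<subseteq> A" "measure \<Lambda> A < measure \<Lambda> K + d"
    using ex_compact_inner[OF \<Omega> \<Lambda> base(1) d] by blast
  have KM: "K \<in> sets \<Lambda>"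
    using K \<Omega> \<open>A \<subseteq> \<Omega>\<close> unfolding \<Lambda>(2) by (auto simp: sets_restrict_space_iff compact_imp_closed)
  obtain \<phi> where \<phi>: "\<phi> \<in> Cc \<Omega>" "(\<integral>x. \<bar>indicator K x - \<phi> x\<bar> \<partial>\<Lambda>) < d"
    using Cc_dense_indicator_compact[OF \<Omega> \<Lambda> K(1) _ d] K(2) \<open>A \<subseteq> \<Omega>\<close> by blast
  have int\<phi>: "integrable \<Lambda> \<phi>" by (rule Cc_integrable[OF \<phi>(1) \<Lambda>])
  have intA: "integrable \<Lambda> (indicator A :: 'a \<Rightarrow> real)" and intK: "integrable \<Lambda> (indicator K :: 'a \<Rightarrow> real)"
    using base KM by (auto simp: emeasure_finite less_top[symmetric])
  let ?\<sigma> = "\<lambda>x. \<phi> x *\<^sub>R c"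
  have "?\<sigma> \<in> Cc \<Omega>"
    by (rule Cc_support[OF \<phi>(1)]) (auto intro!: continuous_intros Cc_continuous[OF \<phi>(1)])
  moreover have "(\<integral>x. norm (indicator A x *\<^sub>R c - ?\<sigma> x) \<partial>\<Lambda>) < e"
  proof -
    have "(\<integral>x. norm (indicator A x *\<^sub>R c - ?\<sigma> x) \<partial>\<Lambda>) = (\<integral>x. \<bar>indicator A x - \<phi> x\<bar> * norm c \<partial>\<Lambda>)"
      by (simp flip: scaleR_diff_left)
    also have "\<dots> = norm c * (\<integral>x. \<bar>indicator A x - \<phi> x\<bar> \<partial>\<Lambda>)" by simp
    also have "(\<integral>x. \<bar>indicator A x - \<phi> x\<bar> \<partial>\<Lambda>)
        \<le> (\<integral>x. (indicator A x - indicator K x) + \<bar>indicator K x - \<phi> x\<bar> \<partial>\<Lambda>)"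
    proof (rule integral_mono)
      show "integrable \<Lambda> (\<lambda>x. \<bar>indicator A x - \<phi> x\<bar>)"
        "integrable \<Lambda> (\<lambda>x. (indicator A x - indicator K x) + \<bar>indicator K x - \<phi> x\<bar>)"
        using intA intK int\<phi> by auto
    qed (use K(2) in \<open>auto simp: indicator_def\<close>)
    also have "\<dots> = (measure \<Lambda> A - measure \<Lambda> K) + (\<integral>x. \<bar>indicator K x - \<phi> x\<bar> \<partial>\<Lambda>)"
      using intA intK int\<phi> base(1) KM sets.sets_into_space[OF KM] sets.sets_into_space[OF base(1)]
      by (simp add: Int_absorb2)
    also have "\<dots> \<le> 2 * d" using K \<phi> by simp
    finally have "(\<integral>x. norm (indicator A x *\<^sub>R c - ?\<sigma> x) \<partial>\<Lambda>) \<le> norm c * (2 * d)"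
      by (simp add: mult_left_mono)
    also have "\<dots> < (1 + norm c) * (2 * d)" using d by simp
    also have "\<dots> = e"
    proof -
      have "1 + norm c \<noteq> 0" using norm_ge_zero[of c] by linarith
      then show ?thesis by (simp add: d_def field_simps)
    qed
    finally show ?thesis .
  qed
  ultimately show ?case by (intro bexI[of _ ?\<sigma>])
next
  case (add f g e)
  obtain \<sigma> \<tau> where *: "\<sigma> \<in> Cc \<Omega>" "(\<integral>x. norm (f x - \<sigma> x) \<partial>\<Lambda>) < e / 2"
    "\<tau> \<in> Cc \<Omega>" "(\<integral>x. norm (g x - \<tau> x) \<partial>\<Lambda>) < e / 2"
    using add.IH[of "e / 2"] add.prems by (metis half_gt_zero)
  have int: "integrable \<Lambda> \<sigma>" "integrable \<Lambda> \<tau>" using * Cc_integrable \<Lambda> by blast+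
  have "(\<integral>x. norm (f x + g x - (\<sigma> x + \<tau> x)) \<partial>\<Lambda>) \<le> (\<integral>x. norm (f x - \<sigma> x) + norm (g x - \<tau> x) \<partial>\<Lambda>)"
    using add.hyps int by (intro integral_mono norm_diff_triangle_ineq) auto
  also have "\<dots> < e" using add.hyps int * by simp
  finally show ?case by (intro bexI[of _ "\<lambda>x. \<sigma> x + \<tau> x"] Cc_add[OF *(1,3)])
next
  case (lim f s e)
  have "(\<lambda>i. \<integral>x. norm (f x - s i x) \<partial>\<Lambda>) \<longlonglongrightarrow> (\<integral>x. 0 \<partial>\<Lambda>)"
  proof (rule integral_dominated_convergence[where w="\<lambda>x. 3 * norm (f x)"])
    have "(\<lambda>i. norm (f x - s i x)) \<longlonglongrightarrow> 0" if "x \<in> space \<Lambda>" for x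
      using tendsto_norm[OF tendsto_diff[OF tendsto_const[of "f x"] lim.hyps(2)[OF that]]] by simp
    then show "AE x in \<Lambda>. (\<lambda>i. norm (f x - s i x)) \<longlonglongrightarrow> 0" by simp
    have "norm (f x - s i x) \<le> 3 * norm (f x)" if "x \<in> space \<Lambda>" for i x
      using norm_triangle_ineq4[of "f x" "s i x"] lim.hyps(3)[OF that, of i] by simp
    then show "AE x in \<Lambda>. norm (norm (f x - s i x)) \<le> 3 * norm (f x)" for i by simp
  qed (use lim.hyps in auto)
  then have "eventually (\<lambda>i. (\<integral>x. norm (f x - s i x) \<partial>\<Lambda>) < e / 2) sequentially"
    using lim.prems by (intro order_tendstoD(2)) auto
  then obtain i where i: "(\<integral>x. norm (f x - s i x) \<partial>\<Lambda>) < e / 2"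
    using eventually_happens'[OF sequentially_bot] by blast
  obtain \<sigma> where \<sigma>: "\<sigma> \<in> Cc \<Omega>" "(\<integral>x. norm (s i x - \<sigma> x) \<partial>\<Lambda>) < e / 2"
    using lim.IH[of "e / 2" i] lim.prems by auto
  have int: "integrable \<Lambda> \<sigma>" using \<sigma> Cc_integrable \<Lambda> by blast
  have "(\<integral>x. norm (f x - \<sigma> x) \<partial>\<Lambda>) \<le> (\<integral>x. norm (f x - s i x) + norm (s i x - \<sigma> x) \<partial>\<Lambda>)"
    using lim.hyps(1)[of i] lim.hyps(4) int norm_triangle_ineq[of "f x - s i x" "s i x - \<sigma> x" for x]
    by (intro integral_mono) auto
  also have "\<dots> < e" using lim.hyps(1)[of i] lim.hyps(4) int i \<sigma> by simp
  finally show ?case by (intro bexI[of _ \<sigma>] \<sigma>(1))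
qed

text \<open>The direction \<open>q / \<bar>q\<bar>\<close> is approximated in \<open>L\<^sup>1\<close> with respect to \<open>\<bar>q\<bar>\<Lambda>\<close>. Projecting the
  approximation to the unit ball is a contraction that fixes this direction, so it costs nothing.\<close>

lemma Cc_norming:
  fixes q :: "'a::euclidean_space \<Rightarrow> 'b::euclidean_space"
  assumes \<Omega>: "open \<Omega>" and \<Lambda>: "finite_measure \<Lambda>" "sets \<Lambda> = sets (borel_on \<Omega>)"
    and q: "integrable \<Lambda> q" and e: "e > 0"
  shows "\<exists>W\<in>Cc \<Omega>. (\<forall>x. norm (W x) \<le> 1) \<and> (\<integral>x. norm (q x) \<partial>\<Lambda>) - (\<integral>x. W x \<bullet> q x \<partial>\<Lambda>) < e"
proof -
  have [measurable]: "q \<in> borel_measurable \<Lambda>" using q by auto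
  define D where "D = density \<Lambda> (\<lambda>x. ennreal (norm (q x)))"
  have sD: "sets D = sets (borel_on \<Omega>)" by (simp add: D_def \<Lambda>)
  have "(\<integral>\<^sup>+x. ennreal (norm (q x)) \<partial>\<Lambda>) < \<infinity>" using q by (simp add: integrable_iff_bounded)
  then have fD: "finite_measure D"
    unfolding D_def by (intro finite_measureI) (auto simp: emeasure_density cong: nn_integral_cong)
  let ?f = "\<lambda>x. q x /\<^sub>R norm (q x)"
  have f1: "norm (?f x) \<le> 1" for x by (cases "q x = 0") auto
  have "integrable D ?f"
    using f1 by (intro finite_measure.integrable_const_bound[OF fD, of _ 1]) (auto simp: D_def)
  then obtain \<sigma> where \<sigma>: "\<sigma> \<in> Cc \<Omega>" "(\<integral>x. norm (?f x - \<sigma> x) \<partial>D) < e"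
    using Cc_dense[OF \<Omega> fD sD _ e] by blast
  let ?P = "closest_point (cball 0 1 :: 'b set)"
  define W where "W x = ?P (\<sigma> x)" for x
  have P: "convex (cball 0 1 :: 'b set)" "closed (cball 0 1 :: 'b set)" "(cball 0 1 :: 'b set) \<noteq> {}"
    by auto
  have W: "W \<in> Cc \<Omega>"
  proof (rule Cc_support[OF \<sigma>(1)])
    show "continuous_on UNIV W"
      unfolding W_def
      by (rule continuous_on_compose2[OF continuous_on_closest_point[OF P, of UNIV] Cc_continuous[OF \<sigma>(1)]]) simp
    show "W x = 0" if "\<sigma> x = 0" for x unfolding W_def that by (rule closest_point_self) simp
  qed
  have W1: "norm (W x) \<le> 1" for x
    using closest_point_in_set[OF P(2,3), of "\<sigma> x"] by (simp add: W_def)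
  have Wd: "norm (?f x - W x) \<le> norm (?f x - \<sigma> x)" for x
  proof -
    have "?P (?f x) = ?f x" by (rule closest_point_self) (use f1[of x] in simp)
    then show ?thesis
      using closest_point_lipschitz[OF P, of "?f x" "\<sigma> x"] by (simp add: W_def dist_norm)
  qed
  have intD: "integrable D ?f" "integrable D W" "integrable D \<sigma>"
    by fact (rule Cc_integrable[OF W fD sD], rule Cc_integrable[OF \<sigma>(1) fD sD])
  have [measurable]: "W \<in> borel_measurable \<Lambda>" by (rule Cc_measurable[OF W \<Lambda>(2)])
  have "integrable D (\<lambda>x. norm (?f x - W x))" using intD by simp
  then have int1: "integrable \<Lambda> (\<lambda>x. norm (q x) * norm (?f x - W x))"
    unfolding D_def by (subst (asm) integrable_density) auto
  have "(\<integral>x. norm (q x) \<partial>\<Lambda>) - (\<integral>x. W x \<bullet> q x \<partial>\<Lambda>) = (\<integral>x. norm (q x) - W x \<bullet> q x \<partial>\<Lambda>)"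
    using q Cc_inner_integrable[OF W \<Lambda>(2) q] by simp
  also have "\<dots> \<le> (\<integral>x. norm (q x) * norm (?f x - W x) \<partial>\<Lambda>)"
  proof (rule integral_mono)
    fix x
    have "norm (q x) = ?f x \<bullet> q x"
      by (cases "q x = 0") (auto simp: dot_square_norm power2_eq_square)
    then have "norm (q x) - W x \<bullet> q x = (?f x - W x) \<bullet> q x" by (simp add: inner_diff_left)
    also have "\<dots> \<le> norm (?f x - W x) * norm (q x)" by (rule norm_cauchy_schwarz)
    finally show "norm (q x) - W x \<bullet> q x \<le> norm (q x) * norm (?f x - W x)"
      by (simp add: mult.commute)
  qed (use q Cc_inner_integrable[OF W \<Lambda>(2) q] int1 in auto)
  also have "\<dots> = (\<integral>x. norm (?f x - W x) \<partial>D)"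
    unfolding D_def by (subst integral_density) auto
  also have "\<dots> \<le> (\<integral>x. norm (?f x - \<sigma> x) \<partial>D)"
    using intD Wd by (intro integral_mono) auto
  also have "\<dots> < e" by fact
  finally show ?thesis using W W1 by (intro bexI[of _ W] conjI allI)
qed

section \<open>Reshetnyak continuity of the excess over a continuous field\<close>

text \<open>Multiplied by \<open>2\<bar>b\<bar>\<close>, the difference of the two sides is \<open>(\<bar>a\<bar> - \<bar>b\<bar>)\<^sup>2\<close>.\<close>

lemma norm_minus_projection_le:
  fixes a b :: "'a::real_inner"
  assumes "b \<noteq> 0"
  shows "norm a - (a \<bullet> b) / norm b \<le> (norm (a - b))\<^sup>2 / (2 * norm b)"
proof -
  have "(norm (a - b))\<^sup>2 = (norm a)\<^sup>2 - 2 * (a \<bullet> b) + (norm b)\<^sup>2"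
    by (simp add: power2_norm_eq_inner inner_diff inner_commute)
  moreover have "0 \<le> (norm a - norm b)\<^sup>2" by simp
  ultimately have "2 * (norm a * norm b - a \<bullet> b) \<le> (norm (a - b))\<^sup>2"
    by (simp add: power2_diff)
  then have "2 * (norm a * norm b - a \<bullet> b) / (2 * norm b) \<le> (norm (a - b))\<^sup>2 / (2 * norm b)"
    by (intro divide_right_mono) auto
  then show ?thesis using assms by (simp add: diff_divide_distrib)
qed

text \<open>The convexity estimate behind the upper bound: for large \<open>C\<close> the function \<open>C\<bar>z\<bar> - \<bar>A z\<bar>\<close> lies above its
  tangents, so \<open>\<bar>A z\<bar>\<close> is at most its linearisation plus \<open>C\<close> times the defect \<open>\<bar>z\<bar> - w \<bullet> z\<close>. For unit vectors \<open>u\<close>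
  and \<open>v\<close>, the previous lemma bounds the excess of \<open>\<bar>A v\<bar>\<close> over its component along \<open>A u\<close> by
  \<open>\<bar>A (v - u)\<bar>\<^sup>2 / (2 \<bar>A u\<bar>) \<le> k\<^sup>2 l (1 - u \<bullet> v)\<close>, and homogeneity gives the case of a unit \<open>w\<close>. A shorter
  \<open>w\<close> carries the tangent inequality with weight \<open>\<bar>w\<bar>\<close> only; the remaining fraction
  \<open>(1 - \<bar>w\<bar>) \<bar>A z\<bar>\<close> is itself controlled by the defect. Allowing \<open>\<bar>w\<bar> \<le> 1\<close> is what makes compactly
  supported \<open>w\<close> admissible.\<close>

lemma norm_linear_le_tangent:
  fixes A :: "'a::real_inner \<Rightarrow> 'b::real_inner"
  assumes A: "linear A" "\<And>z. norm (A z) \<le> k * norm z" "\<And>z. norm z \<le> l * norm (A z)"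
    and k: "0 \<le> k" and l: "0 \<le> l" and w: "norm w \<le> 1"
  shows "norm (A z) \<le> (norm w / norm (A w)) * (A w \<bullet> A z) + (k\<^sup>2 * l + k) * (norm z - w \<bullet> z)"
proof -
  have wz: "w \<bullet> z \<le> norm w * norm z" by (rule norm_cauchy_schwarz)
  also have "\<dots> \<le> 1 * norm z" using w by (intro mult_right_mono) auto
  finally have wz1: "w \<bullet> z \<le> norm z" by simp
  have rest: "(1 - norm w) * norm (A z) \<le> k * (norm z - w \<bullet> z)"
  proof -
    have "(1 - norm w) * norm (A z) \<le> (1 - norm w) * (k * norm z)"
      using w A(2) by (intro mult_left_mono) auto
    also have "\<dots> = k * (norm z - norm w * norm z)" by (simp add: algebra_simps)
    also have "\<dots> \<le> k * (norm z - w \<bullet> z)" using wz k by (intro mult_left_mono) auto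
    finally show ?thesis .
  qed
  show ?thesis
  proof (cases "w = 0 \<or> z = 0")
    case True
    then show ?thesis
    proof
      assume "z = 0"
      then show ?thesis using linear_0[OF A(1)] by simp
    next
      assume "w = 0"
      moreover have "0 \<le> k\<^sup>2 * l * norm z" using k l by simp
      ultimately show ?thesis using A(2)[of z] by (simp add: algebra_simps)
    qed
  next
    case False
    define u where "u = w /\<^sub>R norm w"
    define v where "v = z /\<^sub>R norm z"
    have u: "norm u = 1" "w = norm w *\<^sub>R u" and v: "norm v = 1" "z = norm z *\<^sub>R v"
      using False by (auto simp: u_def v_def)
    have Au: "1 \<le> l * norm (A u)" using A(3)[of u] u by simp
    then have Au0: "A u \<noteq> 0" by auto
    have "norm (A v) - (A v \<bullet> A u) / norm (A u) \<le> (norm (A v - A u))\<^sup>2 / (2 * norm (A u))"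
      by (rule norm_minus_projection_le[OF Au0])
    also have "\<dots> \<le> (norm (A v - A u))\<^sup>2 * l / 2"
    proof -
      have "(norm (A v - A u))\<^sup>2 * 1 \<le> (norm (A v - A u))\<^sup>2 * (l * norm (A u))"
        using Au by (intro mult_left_mono) auto
      then show ?thesis using Au0 by (simp add: field_simps)
    qed
    also have "\<dots> \<le> (k * norm (v - u))\<^sup>2 * l / 2"
      using A(2)[of "v - u"] l linear_diff[OF A(1), of v u]
      by (intro divide_right_mono mult_right_mono power_mono) auto
    also have "\<dots> = k\<^sup>2 * l * (1 - u \<bullet> v)"
    proof -
      have dist: "(norm (v - u))\<^sup>2 = 2 - 2 * (u \<bullet> v)"
        using u(1) v(1) by (simp add: power2_norm_eq_inner inner_diff inner_commute norm_eq_1)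
      show ?thesis unfolding power_mult_distrib dist by (simp add: field_simps)
    qed
    finally have unit: "norm (A v) - (A v \<bullet> A u) / norm (A u) \<le> k\<^sup>2 * l * (1 - u \<bullet> v)" .
    have Az: "A z = norm z *\<^sub>R A v" using v(2) linear_scale[OF A(1)] by metis
    have Aw: "A w = norm w *\<^sub>R A u" using u(2) linear_scale[OF A(1)] by metis
    have quot: "(A w \<bullet> A z) / norm (A w) = norm z * ((A v \<bullet> A u) / norm (A u))"
      using False by (simp add: Az Aw inner_commute)
    have "norm w * norm (A z) - norm w * ((A w \<bullet> A z) / norm (A w))
        = norm w * norm z * (norm (A v) - (A v \<bullet> A u) / norm (A u))"
      unfolding quot by (simp add: Az algebra_simps)
    also have "\<dots> \<le> norm w * norm z * (k\<^sup>2 * l * (1 - u \<bullet> v))"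
      by (intro mult_left_mono unit) auto
    also have "\<dots> = k\<^sup>2 * l * (norm w * norm z - w \<bullet> z)"
    proof -
      have "w \<bullet> z = (norm w *\<^sub>R u) \<bullet> (norm z *\<^sub>R v)"
        by (simp only: u(2)[symmetric] v(2)[symmetric])
      then have "w \<bullet> z = norm w * norm z * (u \<bullet> v)" by simp
      then show ?thesis by (simp add: algebra_simps)
    qed
    also have "\<dots> \<le> k\<^sup>2 * l * (norm z - w \<bullet> z)"
      using w k l by (intro mult_left_mono diff_right_mono mult_left_le_one_le) auto
    finally show ?thesis using rest by (simp add: algebra_simps)
  qed
qed

text \<open>The factor \<open>c\<close> may be discontinuous at zeros of \<open>b\<close>; this is the situation for
  \<open>\<bar>W\<bar> / \<bar>A W\<bar>\<close> at zeros of \<open>W\<close>.\<close>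

lemma continuous_on_scaleR_bounded:
  fixes b :: "'a::t2_space \<Rightarrow> 'b::real_normed_vector" and c :: "'a \<Rightarrow> real"
  assumes b: "continuous_on UNIV b" and c: "\<And>x. b x \<noteq> 0 \<Longrightarrow> isCont c x" "\<And>x. \<bar>c x\<bar> \<le> K"
  shows "continuous_on UNIV (\<lambda>x. c x *\<^sub>R b x)"
proof -
  have b': "isCont b x" for x using b by (simp add: continuous_on_eq_continuous_at)
  have "isCont (\<lambda>x. c x *\<^sub>R b x) x" for x
  proof (cases "b x = 0")
    case False
    then show ?thesis using b' c(1) by (intro continuous_intros)
  next
    case True
    have "(b \<longlongrightarrow> 0) (at x)" using b'[of x] True by (simp add: isCont_def)
    then have "((\<lambda>y. K * norm (b y)) \<longlongrightarrow> 0) (at x)" by (auto intro!: tendsto_eq_intros)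
    moreover have "\<forall>\<^sub>F y in at x. norm (c y *\<^sub>R b y) \<le> K * norm (b y)"
      using c(2) by (intro always_eventually allI) (simp add: mult_right_mono)
    ultimately have "((\<lambda>y. c y *\<^sub>R b y) \<longlongrightarrow> 0) (at x)"
      by (rule Lim_null_comparison[rotated])
    then show ?thesis using True by (simp add: isCont_def)
  qed
  then show ?thesis by (simp add: continuous_at_imp_continuous_on)
qed

text \<open>Reshetnyak continuity for the integrand \<open>\<bar>p - t G(x)\<bar>\<close>. Only pairings with compactly supported
  fields and total masses are known to converge, so both bounds compare the integrand with such
  expressions.\<close>

lemma graph_excess_continuous:
  fixes z0 :: "'a::euclidean_space \<Rightarrow> real \<times> 'b::euclidean_space"
    and Z :: "nat \<Rightarrow> 'a \<Rightarrow> real \<times> 'b" and G :: "'a \<Rightarrow> 'b"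
  assumes \<Omega>: "open \<Omega>"
    and \<Lambda>0: "finite_measure \<Lambda>0" "sets \<Lambda>0 = sets (borel_on \<Omega>)" "integrable \<Lambda>0 z0"
    and \<Lambda>: "\<And>h. finite_measure (\<Lambda> h)" "\<And>h. sets (\<Lambda> h) = sets (borel_on \<Omega>)" "\<And>h. integrable (\<Lambda> h) (Z h)"
    and weak: "\<And>W::'a \<Rightarrow> real \<times> 'b. W \<in> Cc \<Omega> \<Longrightarrow>
      (\<lambda>h. \<integral>x. W x \<bullet> Z h x \<partial>\<Lambda> h) \<longlonglongrightarrow> (\<integral>x. W x \<bullet> z0 x \<partial>\<Lambda>0)"
    and mass: "(\<lambda>h. \<integral>x. norm (Z h x) \<partial>\<Lambda> h) \<longlonglongrightarrow> (\<integral>x. norm (z0 x) \<partial>\<Lambda>0)"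
    and G: "G \<in> Cc \<Omega>"
  shows "(\<lambda>h. \<integral>x. norm (snd (Z h x) - fst (Z h x) *\<^sub>R G x) \<partial>\<Lambda> h)
    \<longlonglongrightarrow> (\<integral>x. norm (snd (z0 x) - fst (z0 x) *\<^sub>R G x) \<partial>\<Lambda>0)"
proof -
  define q where "q z x = snd (z x) - fst (z x) *\<^sub>R G x" for z :: "'a \<Rightarrow> real \<times> 'b" and x
  have int_fst: "integrable N (\<lambda>x. fst (z x))" and int_snd: "integrable N (\<lambda>x. snd (z x))"
    if "integrable N z" for N and z :: "'a \<Rightarrow> real \<times> 'b"
    using integrable_bounded_linear[OF bounded_linear_fst that]
      integrable_bounded_linear[OF bounded_linear_snd that] by simp_all
  have int_q: "integrable N (q z)" if "sets N = sets (borel_on \<Omega>)" "integrable N z" for N z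
    unfolding q_def
    by (intro Bochner_Integration.integrable_diff int_snd int_fst Cc_scaleR_integrable[OF G] that)
  obtain M where M: "0 \<le> M" "\<And>x. norm (G x) \<le> M" using Cc_bounded[OF G] by blast
  have contG: "continuous_on UNIV G" by (rule Cc_continuous[OF G])
  define T where "T = (\<integral>x. norm (z0 x) \<partial>\<Lambda>0)"
  have T: "0 \<le> T" unfolding T_def by simp
  have upper: "\<forall>\<^sub>F h in sequentially. (\<integral>x. norm (q (Z h) x) \<partial>\<Lambda> h) < (\<integral>x. norm (q z0 x) \<partial>\<Lambda>0) + e"
    if e: "e > 0" for e :: real
  proof -
    define \<epsilon> where "\<epsilon> = e / (3 * (1 + T))"
    have \<epsilon>: "\<epsilon> > 0" "\<epsilon> * T \<le> e / 3"
      using e T by (auto simp: \<epsilon>_def field_simps)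
    \<comment> \<open>The small first component makes \<open>A x\<close> invertible, which \<open>(t, p) \<mapsto> p - t G(x)\<close> is not.\<close>
    define A where "A x z = (\<epsilon> * fst z, snd z - fst z *\<^sub>R G x)" for x and z :: "real \<times> 'b"
    have linA: "linear (A x)" for x
      unfolding A_def by (rule linearI) (auto simp: algebra_simps)
    define k where "k = 1 + \<epsilon> + M"
    define l where "l = 1 + (1 + M) / \<epsilon>"
    have k: "0 < k" and l: "0 < l" using \<epsilon> M by (auto simp: k_def l_def add_pos_nonneg)
    have Ak: "norm (A x z) \<le> k * norm z" for x z
    proof -
      have "norm (A x z) \<le> \<epsilon> * \<bar>fst z\<bar> + norm (snd z - fst z *\<^sub>R G x)"
        unfolding A_def using norm_Pair_le[of "\<epsilon> * fst z" "snd z - fst z *\<^sub>R G x"] \<epsilon> by (simp add: abs_mult)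
      also have "norm (snd z - fst z *\<^sub>R G x) \<le> norm (snd z) + \<bar>fst z\<bar> * norm (G x)"
        using norm_triangle_ineq4[of "snd z" "fst z *\<^sub>R G x"] by simp
      also have "\<bar>fst z\<bar> * norm (G x) \<le> \<bar>fst z\<bar> * M" using M by (intro mult_left_mono) auto
      finally have "norm (A x z) \<le> (\<epsilon> + M) * \<bar>fst z\<bar> + norm (snd z)" by (simp add: algebra_simps)
      also have "\<dots> \<le> (\<epsilon> + M) * norm z + norm z"
        using norm_fst_le[of "fst z" "snd z"] norm_snd_le[of "snd z" "fst z"] \<epsilon> M
        by (intro add_mono mult_left_mono) auto
      finally show ?thesis by (simp add: k_def algebra_simps)
    qed
    have Al: "norm z \<le> l * norm (A x z)" for x z
    proof -
      have t: "\<bar>fst z\<bar> \<le> norm (A x z) / \<epsilon>"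
        using norm_fst_le[of "\<epsilon> * fst z" "snd z - fst z *\<^sub>R G x"] \<epsilon>
        by (simp add: A_def abs_mult field_simps)
      have "norm (snd z) \<le> norm (snd z - fst z *\<^sub>R G x) + \<bar>fst z\<bar> * norm (G x)"
        using norm_triangle_ineq[of "snd z - fst z *\<^sub>R G x" "fst z *\<^sub>R G x"] by simp
      also have "\<dots> \<le> norm (A x z) + (norm (A x z) / \<epsilon>) * M"
        using t M norm_snd_le[of "snd z - fst z *\<^sub>R G x" "\<epsilon> * fst z"]
        by (intro add_mono mult_mono) (auto simp: A_def)
      finally have "norm z \<le> norm (A x z) / \<epsilon> + (norm (A x z) + (norm (A x z) / \<epsilon>) * M)"
        using norm_Pair_le[of "fst z" "snd z"] t by simp
      also have "\<dots> = l * norm (A x z)" using \<epsilon> by (simp add: l_def field_simps)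
      finally show ?thesis .
    qed
    define C where "C = k\<^sup>2 * l + k"
    have C: "C > 0" using k l by (simp add: C_def add_nonneg_pos)
    obtain W where W: "W \<in> Cc \<Omega>" "\<And>x. norm (W x) \<le> 1"
        "T - (\<integral>x. W x \<bullet> z0 x \<partial>\<Lambda>0) < e / (3 * C)"
      using Cc_norming[OF \<Omega> \<Lambda>0, of "e / (3 * C)"] e C unfolding T_def by auto
    have contW: "continuous_on UNIV W" by (rule Cc_continuous[OF W(1)])
    define c where "c x = norm (W x) / norm (A x (W x))" for x
    \<comment> \<open>\<open>b x\<close> is the adjoint of \<open>A x\<close> applied to \<open>A x (W x)\<close>, so \<open>a x\<close> is the linearisation in direction \<open>W x\<close>.\<close>
    define b where "b x = (\<epsilon>\<^sup>2 * fst (W x) - (snd (W x) - fst (W x) *\<^sub>R G x) \<bullet> G x,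
      snd (W x) - fst (W x) *\<^sub>R G x)" for x
    define a where "a x = c x *\<^sub>R b x" for x
    have a_inner: "a x \<bullet> z = c x * (A x (W x) \<bullet> A x z)" for x z
      by (cases z) (simp add: a_def b_def A_def inner_Pair inner_diff_left inner_diff_right power2_eq_square algebra_simps)
    have contA: "continuous_on UNIV (\<lambda>x. A x (W x))"
      unfolding A_def by (intro continuous_intros contW contG)
    have aCc: "a \<in> Cc \<Omega>"
    proof (rule Cc_support[OF W(1)])
      have "continuous_on UNIV b"
        unfolding b_def by (intro continuous_intros contW contG)
      moreover have "isCont c x" if "b x \<noteq> 0" for x
      proof -
        have "W x \<noteq> 0" using that by (auto simp: b_def zero_prod_def)
        then have "norm (A x (W x)) \<noteq> 0" using Al[of "W x" x] by auto
        moreover have "isCont W x" "isCont (\<lambda>x. A x (W x)) x"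
          using contW contA by (auto simp: continuous_on_eq_continuous_at)
        ultimately show ?thesis unfolding c_def by (intro continuous_intros)
      qed
      moreover have "\<bar>c x\<bar> \<le> l" for x
        using Al[of "W x" x] l by (cases "A x (W x) = 0") (auto simp: c_def divide_le_eq)
      ultimately show "continuous_on UNIV a"
        unfolding a_def by (rule continuous_on_scaleR_bounded)
      show "a x = 0" if "W x = 0" for x using that by (simp add: a_def c_def)
    qed
    have pointwise: "norm (q z x) \<le> a x \<bullet> z x + C * (norm (z x) - W x \<bullet> z x)" for z x
    proof -
      have "norm (q z x) \<le> norm (A x (z x))"
        using norm_snd_le[of "snd (z x) - fst (z x) *\<^sub>R G x" "\<epsilon> * fst (z x)"] by (simp add: q_def A_def)
      also have "\<dots> \<le> c x * (A x (W x) \<bullet> A x (z x)) + C * (norm (z x) - W x \<bullet> z x)"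
        unfolding c_def C_def using k l by (intro norm_linear_le_tangent linA Ak Al W) auto
      finally show ?thesis by (simp add: a_inner)
    qed
    have tangent: "a x \<bullet> z0 x \<le> norm (q z0 x) + \<epsilon> * norm (z0 x)" for x
    proof -
      have "a x \<bullet> z0 x = norm (W x) * ((A x (W x) \<bullet> A x (z0 x)) / norm (A x (W x)))"
        by (simp add: a_inner c_def)
      also have "\<dots> \<le> norm (W x) * norm (A x (z0 x))"
        using norm_cauchy_schwarz[of "A x (W x)" "A x (z0 x)"]
        by (intro mult_left_mono) (auto simp: divide_le_eq mult.commute)
      also have "\<dots> \<le> norm (A x (z0 x))" using W(2)[of x] by (intro mult_left_le_one_le) auto
      also have "\<dots> \<le> \<epsilon> * \<bar>fst (z0 x)\<bar> + norm (q z0 x)"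
        using norm_Pair_le[of "\<epsilon> * fst (z0 x)" "snd (z0 x) - fst (z0 x) *\<^sub>R G x"] \<epsilon>
        by (simp add: abs_mult A_def q_def)
      also have "\<dots> \<le> \<epsilon> * norm (z0 x) + norm (q z0 x)"
        using norm_fst_le[of "fst (z0 x)" "snd (z0 x)"] \<epsilon> by (intro add_mono mult_left_mono) auto
      finally show ?thesis by simp
    qed
    note int_a = Cc_inner_integrable[OF aCc] and int_W = Cc_inner_integrable[OF W(1)]
    define R where "R h = (\<integral>x. a x \<bullet> Z h x \<partial>\<Lambda> h)
      + C * ((\<integral>x. norm (Z h x) \<partial>\<Lambda> h) - (\<integral>x. W x \<bullet> Z h x \<partial>\<Lambda> h))" for h
    define R0 where "R0 = (\<integral>x. a x \<bullet> z0 x \<partial>\<Lambda>0) + C * (T - (\<integral>x. W x \<bullet> z0 x \<partial>\<Lambda>0))"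
    have "R \<longlonglongrightarrow> R0"
      unfolding R_def R0_def T_def by (intro tendsto_intros weak mass aCc W)
    moreover have "R0 < (\<integral>x. norm (q z0 x) \<partial>\<Lambda>0) + e"
    proof -
      have "(\<integral>x. a x \<bullet> z0 x \<partial>\<Lambda>0) \<le> (\<integral>x. norm (q z0 x) + \<epsilon> * norm (z0 x) \<partial>\<Lambda>0)"
        using int_a[OF \<Lambda>0(2,3)] int_q[OF \<Lambda>0(2,3)] \<Lambda>0(3) tangent by (intro integral_mono) auto
      also have "\<dots> = (\<integral>x. norm (q z0 x) \<partial>\<Lambda>0) + \<epsilon> * T"
        using int_q[OF \<Lambda>0(2,3)] \<Lambda>0(3) by (simp add: T_def)
      finally have "(\<integral>x. a x \<bullet> z0 x \<partial>\<Lambda>0) \<le> (\<integral>x. norm (q z0 x) \<partial>\<Lambda>0) + e / 3"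
        using \<epsilon>(2) by simp
      moreover have "C * (T - (\<integral>x. W x \<bullet> z0 x \<partial>\<Lambda>0)) < C * (e / (3 * C))"
        using W(3) C by (intro mult_strict_left_mono)
      moreover have "C * (e / (3 * C)) = e / 3" using C by simp
      ultimately show ?thesis using e unfolding R0_def by linarith
    qed
    ultimately have "\<forall>\<^sub>F h in sequentially. R h < (\<integral>x. norm (q z0 x) \<partial>\<Lambda>0) + e"
      by (rule order_tendstoD(2))
    moreover have "(\<integral>x. norm (q (Z h) x) \<partial>\<Lambda> h) \<le> R h" for h
    proof -
      have "(\<integral>x. norm (q (Z h) x) \<partial>\<Lambda> h)
          \<le> (\<integral>x. a x \<bullet> Z h x + C * (norm (Z h x) - W x \<bullet> Z h x) \<partial>\<Lambda> h)"
        using int_a[OF \<Lambda>(2,3)] int_W[OF \<Lambda>(2,3)] int_q[OF \<Lambda>(2,3)] \<Lambda>(3) pointwise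
        by (intro integral_mono) auto
      also have "\<dots> = R h"
        using int_a[OF \<Lambda>(2,3)] int_W[OF \<Lambda>(2,3)] \<Lambda>(3) by (simp add: R_def)
      finally show ?thesis .
    qed
    ultimately show ?thesis by (auto elim!: eventually_mono intro: le_less_trans)
  qed
  have lower: "\<forall>\<^sub>F h in sequentially. (\<integral>x. norm (q z0 x) \<partial>\<Lambda>0) - e < (\<integral>x. norm (q (Z h) x) \<partial>\<Lambda> h)"
    if e: "e > 0" for e :: real
  proof -
    obtain V where V: "V \<in> Cc \<Omega>" "\<And>x. norm (V x) \<le> 1"
        "(\<integral>x. norm (q z0 x) \<partial>\<Lambda>0) - (\<integral>x. V x \<bullet> q z0 x \<partial>\<Lambda>0) < e"
      using Cc_norming[OF \<Omega> \<Lambda>0(1,2) int_q[OF \<Lambda>0(2,3)] e] by auto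
    \<comment> \<open>The adjoint of \<open>(t, p) \<mapsto> p - t G(x)\<close> applied to \<open>V x\<close>.\<close>
    define a where "a x = (- (V x \<bullet> G x), V x)" for x
    have aCc: "a \<in> Cc \<Omega>"
      unfolding a_def by (rule Cc_support[OF V(1)])
        (auto intro!: continuous_intros contG Cc_continuous[OF V(1)] simp: zero_prod_def)
    have a_inner: "a x \<bullet> z x = V x \<bullet> q z x" for z x
      by (cases "z x") (simp add: a_def q_def inner_Pair inner_diff_right)
    have "(\<lambda>h. \<integral>x. V x \<bullet> q (Z h) x \<partial>\<Lambda> h) \<longlonglongrightarrow> (\<integral>x. V x \<bullet> q z0 x \<partial>\<Lambda>0)"
      using weak[OF aCc] by (simp add: a_inner)
    moreover have "(\<integral>x. norm (q z0 x) \<partial>\<Lambda>0) - e < (\<integral>x. V x \<bullet> q z0 x \<partial>\<Lambda>0)" using V(3) by simp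
    ultimately have "\<forall>\<^sub>F h in sequentially. (\<integral>x. norm (q z0 x) \<partial>\<Lambda>0) - e < (\<integral>x. V x \<bullet> q (Z h) x \<partial>\<Lambda> h)"
      by (rule order_tendstoD(1))
    moreover have "(\<integral>x. V x \<bullet> q (Z h) x \<partial>\<Lambda> h) \<le> (\<integral>x. norm (q (Z h) x) \<partial>\<Lambda> h)" for h
    proof (rule integral_mono)
      show "V x \<bullet> q (Z h) x \<le> norm (q (Z h) x)" for x
        using norm_cauchy_schwarz[of "V x" "q (Z h) x"] mult_right_mono[OF V(2)[of x] norm_ge_zero[of "q (Z h) x"]]
        by simp
    qed (use Cc_inner_integrable[OF V(1) \<Lambda>(2) int_q[OF \<Lambda>(2,3)]] int_q[OF \<Lambda>(2,3)] in auto)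
    ultimately show ?thesis by (auto elim!: eventually_mono intro: less_le_trans)
  qed
  have "(\<lambda>h. \<integral>x. norm (q (Z h) x) \<partial>\<Lambda> h) \<longlonglongrightarrow> (\<integral>x. norm (q z0 x) \<partial>\<Lambda>0)"
  proof (rule order_tendstoI)
    fix y assume "y < (\<integral>x. norm (q z0 x) \<partial>\<Lambda>0)"
    then show "\<forall>\<^sub>F h in sequentially. y < (\<integral>x. norm (q (Z h) x) \<partial>\<Lambda> h)"
      using lower[of "(\<integral>x. norm (q z0 x) \<partial>\<Lambda>0) - y"] by simp
  next
    fix y assume "(\<integral>x. norm (q z0 x) \<partial>\<Lambda>0) < y"
    then show "\<forall>\<^sub>F h in sequentially. (\<integral>x. norm (q (Z h) x) \<partial>\<Lambda> h) < y"
      using upper[of "y - (\<integral>x. norm (q z0 x) \<partial>\<Lambda>0)"] by simp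
  qed
  then show ?thesis by (simp add: q_def)
qed

section \<open>Lebesgue integrals over a Borel set\<close>

abbreviation lborel_on :: "'a::euclidean_space set \<Rightarrow> 'a measure" where
  "lborel_on \<Omega> \<equiv> restrict_space lborel \<Omega>"

lemma sets_lborel_on: "sets (lborel_on \<Omega>) = sets (borel_on \<Omega>)"
  by (rule sets_restrict_space_cong) simp

lemma Cc_imp_C0:
  assumes "\<phi> \<in> Cc \<Omega>"
  shows "\<phi> \<in> C0 \<Omega>"
proof -
  obtain K where K: "compact K" "K \<subseteq> \<Omega>" "\<And>x. x \<notin> K \<Longrightarrow> \<phi> x = 0"
    using assms unfolding Cc_def by blast
  have cont: "continuous_on UNIV \<phi>" by (rule Cc_continuous[OF assms])
  have "compact {x \<in> \<Omega>. e \<le> \<bar>\<phi> x\<bar>}" if e: "e > 0" for e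
  proof -
    have "\<phi> x \<noteq> 0" if "e \<le> \<bar>\<phi> x\<bar>" for x using that e by auto
    then have "{x \<in> \<Omega>. e \<le> \<bar>\<phi> x\<bar>} = K \<inter> {x. e \<le> \<bar>\<phi> x\<bar>}" using K(2,3) by blast
    moreover have "closed {x. e \<le> \<bar>\<phi> x\<bar>}"
      by (intro closed_Collect_le continuous_intros cont)
    ultimately show ?thesis using K(1) by (simp add: compact_Int_closed)
  qed
  moreover have "continuous_on \<Omega> \<phi>" by (rule continuous_on_subset[OF cont]) simp
  ultimately show ?thesis by (simp add: C0_def)
qed

lemma nn_integral_lebesgue_lborel_on:
  assumes \<Omega>: "\<Omega> \<in> sets borel"
    and ae: "AE x in lebesgue. x \<in> \<Omega> \<longrightarrow> F x = F' x"
  shows "(\<integral>\<^sup>+x\<in>\<Omega>. F x \<partial>lebesgue) = (\<integral>\<^sup>+x. F' x \<partial>lborel_on \<Omega>)"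
proof -
  have "(\<integral>\<^sup>+x\<in>\<Omega>. F x \<partial>lebesgue) = (\<integral>\<^sup>+x\<in>\<Omega>. F' x \<partial>lebesgue)"
    using ae by (intro nn_integral_cong_AE) (auto simp: indicator_def)
  also have "\<dots> = (\<integral>\<^sup>+x\<in>\<Omega>. F' x \<partial>lborel)" by (rule nn_integral_completion)
  also have "\<dots> = (\<integral>\<^sup>+x. F' x \<partial>lborel_on \<Omega>)"
    using \<Omega> by (subst nn_integral_restrict_space) auto
  finally show ?thesis .
qed

lemma integrable_lborel_on_iff:
  fixes g :: "'a::euclidean_space \<Rightarrow> 'b::euclidean_space"
  assumes \<Omega>: "\<Omega> \<in> sets borel" and g: "g \<in> borel_measurable (lborel_on \<Omega>)"
  shows "integrable (lborel_on \<Omega>) g \<longleftrightarrow> set_integrable lebesgue \<Omega> g"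
proof -
  have "(\<lambda>x. indicator \<Omega> x *\<^sub>R g x) \<in> borel_measurable lborel"
    using g \<Omega> by (subst (asm) borel_measurable_restrict_space_iff) auto
  then show ?thesis
    using \<Omega> by (simp add: integrable_restrict_space set_integrable_def integrable_completion)
qed

lemma set_integral_lebesgue_lborel_on:
  fixes g :: "'a::euclidean_space \<Rightarrow> 'b::euclidean_space"
  assumes \<Omega>: "\<Omega> \<in> sets borel" and g: "set_integrable lebesgue \<Omega> g"
    and g': "g' \<in> borel_measurable (lborel_on \<Omega>)"
    and ae: "AE x in lebesgue. x \<in> \<Omega> \<longrightarrow> g x = g' x"
    and A: "A \<in> sets (borel_on \<Omega>)"
  shows "(LINT x:A|lebesgue. g x) = (LINT x:A|lborel_on \<Omega>. g' x)"
proof -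
  have A': "A \<in> sets borel" "A \<subseteq> \<Omega>" using A \<Omega> by (auto simp: sets_restrict_space_iff)
  have m': "(\<lambda>x. indicator \<Omega> x *\<^sub>R g' x) \<in> borel_measurable lborel"
    using g' \<Omega> by (subst (asm) borel_measurable_restrict_space_iff) auto
  have m: "(\<lambda>x. indicator \<Omega> x *\<^sub>R g x) \<in> borel_measurable lebesgue"
    using g unfolding set_integrable_def by (rule borel_measurable_integrable)
  have "(LINT x:A|lebesgue. g x) = (LINT x:A|lebesgue. indicator \<Omega> x *\<^sub>R g x)"
    using A' unfolding set_lebesgue_integral_def
    by (intro Bochner_Integration.integral_cong refl) (auto simp: indicator_def)
  also have "\<dots> = (LINT x:A|lebesgue. indicator \<Omega> x *\<^sub>R g' x)"
    unfolding set_lebesgue_integral_def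
  proof (rule integral_cong_AE)
    show "(\<lambda>x. indicator A x *\<^sub>R indicator \<Omega> x *\<^sub>R g x) \<in> borel_measurable lebesgue"
      "(\<lambda>x. indicator A x *\<^sub>R indicator \<Omega> x *\<^sub>R g' x) \<in> borel_measurable lebesgue"
    proof -
      have iA: "(\<lambda>x. indicator A x :: real) \<in> borel_measurable lebesgue"
        using A'(1) by (intro borel_measurable_indicator sets_completionI_sets) simp
      show "(\<lambda>x. indicator A x *\<^sub>R indicator \<Omega> x *\<^sub>R g x) \<in> borel_measurable lebesgue"
        by (rule borel_measurable_scaleR[OF iA m])
      show "(\<lambda>x. indicator A x *\<^sub>R indicator \<Omega> x *\<^sub>R g' x) \<in> borel_measurable lebesgue"
        by (rule borel_measurable_scaleR[OF iA measurable_completion[OF m']])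
    qed
    show "AE x in lebesgue. indicator A x *\<^sub>R indicator \<Omega> x *\<^sub>R g x = indicator A x *\<^sub>R indicator \<Omega> x *\<^sub>R g' x"
      using ae by eventually_elim (auto simp: indicator_def)
  qed
  also have "\<dots> = (LINT x:A|lborel. indicator \<Omega> x *\<^sub>R g' x)"
    unfolding set_lebesgue_integral_def
  proof (rule integral_completion)
    have "(\<lambda>x. indicator A x :: real) \<in> borel_measurable lborel"
      using A'(1) by (intro borel_measurable_indicator) simp
    then show "(\<lambda>x. indicator A x *\<^sub>R indicator \<Omega> x *\<^sub>R g' x) \<in> borel_measurable lborel"
      by (rule borel_measurable_scaleR) (rule m')
  qed
  also have "\<dots> = (LINT x:A|lborel_on \<Omega>. g' x)"
    using \<Omega> by (subst set_integral_restrict_space) auto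
  finally show ?thesis .
qed

text \<open>The approximate gradient is only Lebesgue measurable, whereas \<open>\<Lambda>\<close> is a Borel measure; this
  supplies the Borel function that replaces it.\<close>

lemma ex_borel_representative:
  fixes g :: "'a::euclidean_space \<Rightarrow> 'b::euclidean_space"
  assumes \<Omega>: "\<Omega> \<in> sets borel" and g: "set_integrable lebesgue \<Omega> g"
  obtains g' where "integrable (lborel_on \<Omega>) g'" "AE x in lebesgue. x \<in> \<Omega> \<longrightarrow> g x = g' x"
proof -
  let ?f = "\<lambda>x. indicator \<Omega> x *\<^sub>R g x"
  have f: "?f \<in> borel_measurable lebesgue"
    using g unfolding set_integrable_def by (rule borel_measurable_integrable)
  have "\<exists>h\<in>borel_measurable lborel. AE x in lborel. ?f x \<bullet> b = h x" for b
    using f by (intro completion_ex_borel_measurable_real borel_measurable_inner) auto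
  then obtain h where h: "\<And>b. h b \<in> borel_measurable lborel" "\<And>b. AE x in lborel. ?f x \<bullet> b = h b x"
    by metis
  define g' where "g' x = (\<Sum>b\<in>Basis. h b x *\<^sub>R b)" for x
  have m: "g' \<in> borel_measurable lborel"
    unfolding g'_def using h(1) by (intro borel_measurable_sum borel_measurable_scaleR) auto
  have "AE x in lborel. \<forall>b\<in>Basis. ?f x \<bullet> b = h b x"
    using h(2) by (intro AE_finite_allI) auto
  then have "AE x in lborel. ?f x = g' x"
  proof eventually_elim
    case (elim x)
    then have "g' x = (\<Sum>b\<in>Basis. (?f x \<bullet> b) *\<^sub>R b)" unfolding g'_def by (intro sum.cong) auto
    then show ?case using euclidean_representation[of "?f x"] by (rule trans[THEN sym])
  qed
  then have ae: "AE x in lebesgue. ?f x = g' x" by (rule AE_completion)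
  have "AE x in lebesgue. x \<in> \<Omega> \<longrightarrow> g x = g' x"
    using ae by eventually_elim (auto simp: indicator_def)
  moreover have "integrable lebesgue g'"
    using ae g f measurable_completion[OF m] unfolding set_integrable_def
    by (subst integrable_cong_AE[where g="?f"]) (auto elim: eventually_mono)
  then have "integrable lborel g'" using m by (simp add: integrable_completion)
  then have "integrable (lborel_on \<Omega>) g'"
    using \<Omega> by (subst integrable_restrict_space) (auto intro: integrable_mult_indicator)
  ultimately show thesis using that by blast
qed


section \<open>The graph measure of a BV function\<close>

text \<open>\<open>(\<tau>, p)\<close> is the density of the graph measure \<open>(\<L>, Dv)\<close> with respect to \<open>\<Lambda>\<close>, and \<open>g\<close> is a Borel
  representative of the approximate gradient. The absolutely continuous part of \<open>Dv\<close> lives where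
  \<open>\<tau> \<noteq> 0\<close>, the singular part where \<open>\<tau> = 0\<close>.\<close>

locale graph_density =
  fixes \<Omega> :: "(real^'n) set" and v :: "real^'n \<Rightarrow> real^'m"
    and \<Lambda> :: "(real^'n) measure" and \<tau> :: "real^'n \<Rightarrow> real"
    and p g :: "real^'n \<Rightarrow> real^'n^'m"
  assumes open_\<Omega>: "open \<Omega>"
    and finite_\<Lambda>: "finite_measure \<Lambda>" and sets_\<Lambda>: "sets \<Lambda> = sets (borel_on \<Omega>)"
    and \<tau>_integrable: "integrable \<Lambda> \<tau>" and \<tau>_nonneg: "\<And>x. 0 \<le> \<tau> x"
    and lborel_density: "lborel_on \<Omega> = density \<Lambda> (\<lambda>x. ennreal (\<tau> x))"
    and p_integrable: "integrable \<Lambda> p"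
    and derivative_density: "\<And>A. A \<in> sets (borel_on \<Omega>) \<Longrightarrow> distr_deriv \<Omega> v A = (LINT x:A|\<Lambda>. p x)"
    and g_integrable: "integrable (lborel_on \<Omega>) g"
    and g_gradient: "AE x in lebesgue. x \<in> \<Omega> \<longrightarrow> approx_gradient \<Omega> v x = g x"
    and p_gradient: "AE x in \<Lambda>. \<tau> x \<noteq> 0 \<longrightarrow> p x = \<tau> x *\<^sub>R g x"
    and singular_density: "\<And>A. A \<in> sets (borel_on \<Omega>) \<Longrightarrow>
      singular_part \<Omega> v A = (LINT x:A|\<Lambda>. (if \<tau> x = 0 then p x else 0))"

text \<open>Densities come from \<open>ex_common_density\<close>. The function \<open>p / \<tau>\<close> (zero where \<open>\<tau> = 0\<close>) witnesses that an
  approximate gradient exists, because \<open>{\<tau> = 0}\<close> is Lebesgue null and carries the remainder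
  \<open>p - \<tau> g\<close>. The chosen approximate gradient is only known to leave a remainder \<open>r = p - \<tau> g\<close>
  concentrated on some null set \<open>S\<close>. But then \<open>\<tau> = 0\<close> almost everywhere on \<open>S\<close> and \<open>r = 0\<close> almost
  everywhere off \<open>S\<close>, which forces \<open>p = \<tau> g\<close> where \<open>\<tau> \<noteq> 0\<close>.\<close>

proposition ex_graph_density:
  fixes v :: "real^'n \<Rightarrow> real^'m"
  assumes \<Omega>: "open \<Omega>" "bounded \<Omega>" and v: "v \<in> BV \<Omega>"
  shows "\<exists>\<Lambda> \<tau> p g. graph_density \<Omega> v \<Lambda> \<tau> p g"
proof -
  have \<Omega>b: "\<Omega> \<in> sets borel" using \<Omega> by simp
  have m: "vector_measure (borel_on \<Omega>) (distr_deriv \<Omega> v)"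
  proof -
    have "\<exists>\<mu>. is_distributional_derivative \<Omega> v \<mu>" using v by (simp add: BV_def)
    then have "is_distributional_derivative \<Omega> v (distr_deriv \<Omega> v)"
      unfolding distr_deriv_def by (rule someI_ex)
    then show ?thesis by (simp add: is_distributional_derivative_def)
  qed
  have finL: "finite_measure (lborel_on \<Omega>)"
    using emeasure_bounded_finite[OF \<Omega>(2)] \<Omega>b
    by (intro finite_measureI) (auto simp: emeasure_restrict_space space_restrict_space)
  obtain \<Lambda> \<tau> p where \<Lambda>: "finite_measure \<Lambda>" "sets \<Lambda> = sets (borel_on \<Omega>)"
    and \<tau>: "\<tau> \<in> borel_measurable \<Lambda>" "\<And>x. 0 \<le> \<tau> x" "lborel_on \<Omega> = density \<Lambda> (\<lambda>x. ennreal (\<tau> x))"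
    and p: "integrable \<Lambda> p" "\<And>A. A \<in> sets (borel_on \<Omega>) \<Longrightarrow> distr_deriv \<Omega> v A = (LINT x:A|\<Lambda>. p x)"
    using ex_common_density[OF m finL sets_lborel_on] by metis
  have [measurable]: "\<tau> \<in> borel_measurable \<Lambda>" "p \<in> borel_measurable \<Lambda>" using \<tau> p by auto
  have mL: "f \<in> borel_measurable (lborel_on \<Omega>) \<longleftrightarrow> f \<in> borel_measurable \<Lambda>" for f :: "real^'n \<Rightarrow> real^'n^'m"
    by (subst measurable_cong_sets[of "lborel_on \<Omega>" \<Lambda> borel borel]) (simp_all only: \<Lambda>(2) sets_lborel_on)
  have "(\<integral>\<^sup>+x. ennreal (\<tau> x) \<partial>\<Lambda>) = emeasure (lborel_on \<Omega>) (space \<Lambda>)"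
    unfolding \<tau>(3) by (subst emeasure_density) (auto intro!: nn_integral_cong)
  then have "integrable \<Lambda> \<tau>"
    using \<tau>(2) finite_measure.emeasure_finite[OF finL]
    by (auto simp: integrable_iff_bounded less_top)
  have int_density: "integrable (lborel_on \<Omega>) f \<longleftrightarrow> integrable \<Lambda> (\<lambda>x. \<tau> x *\<^sub>R f x)"
    if "f \<in> borel_measurable \<Lambda>" for f :: "real^'n \<Rightarrow> real^'n^'m"
    unfolding \<tau>(3) using that \<tau>(2) by (intro integrable_density) auto
  have set_density: "(LINT x:A|lborel_on \<Omega>. f x) = (LINT x:A|\<Lambda>. \<tau> x *\<^sub>R f x)"
    if "f \<in> borel_measurable \<Lambda>" "A \<in> sets (borel_on \<Omega>)" for f :: "real^'n \<Rightarrow> real^'n^'m" and A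
  proof -
    have "A \<in> sets \<Lambda>" using that \<Lambda>(2) by simp
    then have "(\<lambda>x. indicator A x *\<^sub>R f x) \<in> borel_measurable \<Lambda>" using that(1) by simp
    then show ?thesis
      unfolding \<tau>(3) set_lebesgue_integral_def using \<tau>(2)
      by (subst integral_density) (auto simp: mult.commute)
  qed
  have residual: "distr_deriv \<Omega> v A - (LINT x:A|lebesgue. f x) = (LINT x:A|\<Lambda>. p x - \<tau> x *\<^sub>R f' x)"
    if f: "set_integrable lebesgue \<Omega> f" and f': "integrable (lborel_on \<Omega>) f'"
      and ae: "AE x in lebesgue. x \<in> \<Omega> \<longrightarrow> f x = f' x" and A: "A \<in> sets (borel_on \<Omega>)" for f f' A
  proof -
    have mf: "f' \<in> borel_measurable (lborel_on \<Omega>)" using f' by (rule borel_measurable_integrable)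
    have A\<Lambda>: "A \<in> sets \<Lambda>" using A \<Lambda>(2) by simp
    have "(LINT x:A|lebesgue. f x) = (LINT x:A|\<Lambda>. \<tau> x *\<^sub>R f' x)"
      using set_integral_lebesgue_lborel_on[OF \<Omega>b f mf ae A] set_density[OF _ A] mf mL by simp
    moreover have "set_integrable \<Lambda> A p"
      unfolding set_integrable_def by (rule integrable_mult_indicator[OF A\<Lambda> p(1)])
    moreover have "set_integrable \<Lambda> A (\<lambda>x. \<tau> x *\<^sub>R f' x)"
      unfolding set_integrable_def using f' int_density mf mL
      by (intro integrable_mult_indicator[OF A\<Lambda>]) simp
    ultimately show ?thesis using p(2)[OF A] by (simp add: set_integral_diff)
  qed
  have "\<exists>f. set_integrable lebesgue \<Omega> f \<and>
      lebesgue_singular \<Omega> (\<lambda>A. distr_deriv \<Omega> v A - (LINT x:A|lebesgue. f x))"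
  proof -
    define f where "f x = p x /\<^sub>R \<tau> x" for x
    have [measurable]: "f \<in> borel_measurable \<Lambda>" unfolding f_def by measurable
    have \<tau>f: "\<tau> x *\<^sub>R f x = (if \<tau> x = 0 then 0 else p x)" for x by (simp add: f_def)
    have "integrable \<Lambda> (\<lambda>x. \<tau> x *\<^sub>R f x)"
      by (rule Bochner_Integration.integrable_bound[OF p(1)]) (auto simp: \<tau>f)
    then have f: "integrable (lborel_on \<Omega>) f" using int_density by simp
    then have f': "set_integrable lebesgue \<Omega> f"
      using integrable_lborel_on_iff[OF \<Omega>b] borel_measurable_integrable by blast
    define S where "S = {x \<in> space \<Lambda>. \<tau> x = 0}"
    have S\<Lambda>: "S \<in> sets \<Lambda>" unfolding S_def by measurable
    have sp: "space \<Lambda> = \<Omega>" using sets_eq_imp_space_eq[OF \<Lambda>(2)] by (simp add: space_restrict_space)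
    have S: "S \<in> sets (borel_on \<Omega>)" using S\<Lambda> \<Lambda>(2) by simp
    have "emeasure lborel S = emeasure (lborel_on \<Omega>) S"
      using S \<Omega>b by (subst emeasure_restrict_space) (auto simp: sets_restrict_space_iff)
    also have "\<dots> = (\<integral>\<^sup>+x\<in>S. ennreal (\<tau> x) \<partial>\<Lambda>)"
      unfolding \<tau>(3) using S\<Lambda> by (intro emeasure_density) auto
    also have "\<dots> = 0" by (subst nn_integral_0_iff_AE) (auto simp: S_def S\<Lambda>[unfolded S_def] indicator_def)
    finally have "emeasure lborel S = 0" .
    moreover have "total_variation (borel_on \<Omega>)
        (\<lambda>A. distr_deriv \<Omega> v A - (LINT x:A|lebesgue. f x)) (\<Omega> - S) = 0"
    proof -
      have "\<Omega> - S \<in> sets (borel_on \<Omega>)" using S \<Omega>b by (auto simp: sets_restrict_space_iff)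
      then have "total_variation (borel_on \<Omega>)
          (\<lambda>A. distr_deriv \<Omega> v A - (LINT x:A|lebesgue. f x)) (\<Omega> - S)
          = (\<integral>\<^sup>+x\<in>\<Omega> - S. ennreal (norm (p x - \<tau> x *\<^sub>R f x)) \<partial>\<Lambda>)"
        using p(1) int_density f residual[OF f' f]
        by (intro total_variation_density[OF \<Lambda>(2)]) auto
      also have "\<dots> = (\<integral>\<^sup>+x. 0 \<partial>\<Lambda>)"
        by (intro nn_integral_cong) (auto simp: \<tau>f S_def sp indicator_def)
      finally show ?thesis by simp
    qed
    ultimately show ?thesis using f' S unfolding lebesgue_singular_def by blast
  qed
  then have "set_integrable lebesgue \<Omega> (approx_gradient \<Omega> v) \<and>
      lebesgue_singular \<Omega> (\<lambda>A. distr_deriv \<Omega> v A - (LINT x:A|lebesgue. approx_gradient \<Omega> v x))"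
    unfolding approx_gradient_def by (rule someI_ex)
  then obtain S where G: "set_integrable lebesgue \<Omega> (approx_gradient \<Omega> v)"
    and S: "S \<in> sets (borel_on \<Omega>)" "emeasure lborel S = 0"
      "total_variation (borel_on \<Omega>) (singular_part \<Omega> v) (\<Omega> - S) = 0"
    unfolding lebesgue_singular_def singular_part_def[abs_def] by blast
  obtain g where g: "integrable (lborel_on \<Omega>) g" "AE x in lebesgue. x \<in> \<Omega> \<longrightarrow> approx_gradient \<Omega> v x = g x"
    using ex_borel_representative[OF \<Omega>b G] by blast
  define r where "r x = p x - \<tau> x *\<^sub>R g x" for x
  have [measurable]: "g \<in> borel_measurable \<Lambda>" using borel_measurable_integrable[OF g(1)] mL by simp
  have r: "integrable \<Lambda> r" unfolding r_def using p(1) g(1) int_density by simp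
  have sing: "singular_part \<Omega> v A = (LINT x:A|\<Lambda>. r x)" if "A \<in> sets (borel_on \<Omega>)" for A
    unfolding singular_part_def r_def by (rule residual[OF G g that])
  have sp: "space \<Lambda> = \<Omega>" using sets_eq_imp_space_eq[OF \<Lambda>(2)] by (simp add: space_restrict_space)
  have SM: "S \<in> sets \<Lambda>" "\<Omega> - S \<in> sets \<Lambda>" "\<Omega> - S \<in> sets (borel_on \<Omega>)"
    using S(1) \<Omega>b unfolding \<Lambda>(2) by (auto simp: sets_restrict_space_iff)
  have "(\<integral>\<^sup>+x\<in>\<Omega> - S. ennreal (norm (r x)) \<partial>\<Lambda>) = 0"
    using total_variation_density[OF \<Lambda>(2) r sing SM(3)] S(3) by simp
  then have "AE x in \<Lambda>. ennreal (norm (r x)) * indicator (\<Omega> - S) x = 0"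
    using SM r by (subst (asm) nn_integral_0_iff_AE) auto
  then have ae1: "AE x in \<Lambda>. x \<notin> S \<longrightarrow> r x = 0"
    using AE_space by eventually_elim (auto simp: indicator_def sp)
  have "emeasure (lborel_on \<Omega>) S = 0"
    using S \<Omega>b by (subst emeasure_restrict_space) (auto simp: sets_restrict_space_iff)
  then have "(\<integral>\<^sup>+x\<in>S. ennreal (\<tau> x) \<partial>\<Lambda>) = 0"
    unfolding \<tau>(3) using SM by (subst (asm) emeasure_density) auto
  then have "AE x in \<Lambda>. ennreal (\<tau> x) * indicator S x = 0"
    using SM by (subst (asm) nn_integral_0_iff_AE) auto
  then have ae2: "AE x in \<Lambda>. x \<in> S \<longrightarrow> \<tau> x = 0"
  proof eventually_elim
    case (elim x)
    then show ?case using \<tau>(2)[of x] by (auto simp: indicator_def ennreal_eq_0_iff)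
  qed
  have pg: "AE x in \<Lambda>. \<tau> x \<noteq> 0 \<longrightarrow> p x = \<tau> x *\<^sub>R g x"
    using ae1 ae2 by eventually_elim (auto simp: r_def)
  have "singular_part \<Omega> v A = (LINT x:A|\<Lambda>. (if \<tau> x = 0 then p x else 0))"
    if A: "A \<in> sets (borel_on \<Omega>)" for A
  proof -
    have "A \<in> sets \<Lambda>" using A \<Lambda>(2) by simp
    then have "(LINT x:A|\<Lambda>. r x) = (LINT x:A|\<Lambda>. (if \<tau> x = 0 then p x else 0))"
      unfolding set_lebesgue_integral_def using pg r
      by (intro integral_cong_AE) (auto simp: r_def elim!: eventually_mono)
    then show ?thesis using sing[OF A] by simp
  qed
  then have "graph_density \<Omega> v \<Lambda> \<tau> p g"
    by (intro graph_density.intro \<Omega> \<Lambda> \<tau> p g pg \<open>integrable \<Lambda> \<tau>\<close>)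
  then show ?thesis by blast
qed

lemma norm_one_Pair: "norm (1::real, y) = sqrt (1 + (norm y)\<^sup>2)"
  by (simp add: norm_Pair)

context graph_density
begin

definition singular_mass :: real where
  "singular_mass = (\<integral>x. norm (if \<tau> x = 0 then p x else 0) \<partial>\<Lambda>)"

lemma \<tau>_measurable [measurable]: "\<tau> \<in> borel_measurable \<Lambda>"
  and p_measurable [measurable]: "p \<in> borel_measurable \<Lambda>"
  using \<tau>_integrable p_integrable by auto

lemma space_\<Lambda>: "space \<Lambda> = \<Omega>"
  using sets_eq_imp_space_eq[OF sets_\<Lambda>] by (simp add: space_restrict_space)

lemma \<Omega>_borel: "\<Omega> \<in> sets borel"
  using open_\<Omega> by simp

lemma \<Omega>_sets: "\<Omega> \<in> sets (borel_on \<Omega>)"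
  using \<Omega>_borel by (simp add: sets_restrict_space_iff)

lemma singular_integrable: "integrable \<Lambda> (\<lambda>x. if \<tau> x = 0 then p x else 0)"
  by (rule Bochner_Integration.integrable_bound[OF p_integrable]) auto

lemma singular_mass_nonneg: "0 \<le> singular_mass"
  by (simp add: singular_mass_def)

lemma measurable_lborel_on: "f \<in> borel_measurable (lborel_on \<Omega>) \<longleftrightarrow> f \<in> borel_measurable \<Lambda>"
  by (subst measurable_cong_sets[of "lborel_on \<Omega>" \<Lambda> borel borel]) (simp_all only: sets_\<Lambda> sets_lborel_on)

lemma integrable_lborel_on_density:
  fixes f :: "_ \<Rightarrow> real"
  assumes "integrable (lborel_on \<Omega>) f"
  shows "integrable \<Lambda> (\<lambda>x. \<tau> x * f x)" "(\<integral>x. f x \<partial>lborel_on \<Omega>) = (\<integral>x. \<tau> x * f x \<partial>\<Lambda>)"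
proof -
  have f: "f \<in> borel_measurable \<Lambda>"
    using borel_measurable_integrable[OF assms] by (simp only: measurable_lborel_on)
  show "integrable \<Lambda> (\<lambda>x. \<tau> x * f x)"
    using assms f \<tau>_nonneg unfolding lborel_density by (subst (asm) integrable_density) auto
  show "(\<integral>x. f x \<partial>lborel_on \<Omega>) = (\<integral>x. \<tau> x * f x \<partial>\<Lambda>)"
    using f \<tau>_nonneg unfolding lborel_density by (subst integral_density) auto
qed

lemma finite_lborel_on: "finite_measure (lborel_on \<Omega>)"
proof (rule finite_measureI)
  have "emeasure (lborel_on \<Omega>) (space (lborel_on \<Omega>)) = (\<integral>\<^sup>+x. ennreal (\<tau> x) \<partial>\<Lambda>)"
    unfolding lborel_density by (subst emeasure_density) (auto intro!: nn_integral_cong)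
  also have "\<dots> < \<infinity>"
    using \<tau>_integrable \<tau>_nonneg by (simp add: integrable_iff_bounded)
  finally show "emeasure (lborel_on \<Omega>) (space (lborel_on \<Omega>)) \<noteq> \<infinity>" by simp
qed

text \<open>Every functional needed is the integral over \<open>\<Lambda>\<close> of a 1-homogeneous function \<open>H\<close> of \<open>(\<tau>, p)\<close> that
  reduces to \<open>\<bar>p\<bar>\<close> for \<open>\<tau> = 0\<close>. Homogeneity splits it into an integral of the gradient over \<open>\<Omega>\<close>
  and the mass of the singular part.\<close>

lemma integral_split:
  assumes f: "integrable (lborel_on \<Omega>) f" and H: "H \<in> borel_measurable \<Lambda>"
    and eq: "\<And>x. \<tau> x \<noteq> 0 \<Longrightarrow> p x = \<tau> x *\<^sub>R g x \<Longrightarrow> H x = \<tau> x * f x"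
      "\<And>x. \<tau> x = 0 \<Longrightarrow> H x = norm (p x)"
  shows "(\<integral>x. H x \<partial>\<Lambda>) = (\<integral>x. f x \<partial>lborel_on \<Omega>) + singular_mass"
proof -
  have "AE x in \<Lambda>. H x = \<tau> x * f x + norm (if \<tau> x = 0 then p x else 0)"
    using p_gradient
  proof eventually_elim
    case (elim x)
    then show ?case using eq[of x] by (cases "\<tau> x = 0") auto
  qed
  then have "(\<integral>x. H x \<partial>\<Lambda>) = (\<integral>x. \<tau> x * f x + norm (if \<tau> x = 0 then p x else 0) \<partial>\<Lambda>)"
    using H integrable_lborel_on_density(1)[OF f] by (intro integral_cong_AE) auto
  also have "\<dots> = (\<integral>x. f x \<partial>lborel_on \<Omega>) + singular_mass"
    using integrable_lborel_on_density[OF f] integrable_norm[OF singular_integrable]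
    by (simp add: singular_mass_def)
  finally show ?thesis .
qed

lemma total_variation_derivative:
  "total_variation (borel_on \<Omega>) (distr_deriv \<Omega> v) \<Omega> = ennreal (\<integral>x. norm (p x) \<partial>\<Lambda>)"
proof -
  have "total_variation (borel_on \<Omega>) (distr_deriv \<Omega> v) \<Omega> = (\<integral>\<^sup>+x\<in>\<Omega>. ennreal (norm (p x)) \<partial>\<Lambda>)"
    by (rule total_variation_density[OF sets_\<Lambda> p_integrable derivative_density \<Omega>_sets])
  also have "\<dots> = (\<integral>\<^sup>+x. ennreal (norm (p x)) \<partial>\<Lambda>)"
    by (intro nn_integral_cong) (simp add: space_\<Lambda>)
  also have "\<dots> = ennreal (\<integral>x. norm (p x) \<partial>\<Lambda>)"
    using p_integrable by (intro nn_integral_eq_integral) auto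
  finally show ?thesis .
qed

lemma total_variation_singular:
  "total_variation (borel_on \<Omega>) (singular_part \<Omega> v) \<Omega> = ennreal singular_mass"
proof -
  have "total_variation (borel_on \<Omega>) (singular_part \<Omega> v) \<Omega>
      = (\<integral>\<^sup>+x\<in>\<Omega>. ennreal (norm (if \<tau> x = 0 then p x else 0)) \<partial>\<Lambda>)"
    by (rule total_variation_density[OF sets_\<Lambda> singular_integrable singular_density \<Omega>_sets])
  also have "\<dots> = (\<integral>\<^sup>+x. ennreal (norm (if \<tau> x = 0 then p x else 0)) \<partial>\<Lambda>)"
    by (intro nn_integral_cong) (simp add: space_\<Lambda>)
  also have "\<dots> = ennreal singular_mass"
    unfolding singular_mass_def using integrable_norm[OF singular_integrable]
    by (intro nn_integral_eq_integral) auto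
  finally show ?thesis .
qed

lemma graph_integrable: "integrable \<Lambda> (\<lambda>x. (\<tau> x, p x))"
proof (rule Bochner_Integration.integrable_bound)
  show "integrable \<Lambda> (\<lambda>x. \<tau> x + norm (p x))" using \<tau>_integrable p_integrable by simp
  show "(\<lambda>x. (\<tau> x, p x)) \<in> borel_measurable \<Lambda>"
    by (rule borel_measurable_Pair[OF \<tau>_measurable p_measurable])
  show "AE x in \<Lambda>. norm (\<tau> x, p x) \<le> norm (\<tau> x + norm (p x))"
  proof (rule AE_I2)
    fix x
    show "norm (\<tau> x, p x) \<le> norm (\<tau> x + norm (p x))"
      using norm_Pair_le[of "\<tau> x" "p x"] \<tau>_nonneg[of x] by simp
  qed
qed

lemma norm_one_gradient_integrable: "integrable (lborel_on \<Omega>) (\<lambda>x. norm (1::real, g x))"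
proof (rule Bochner_Integration.integrable_bound)
  show "integrable (lborel_on \<Omega>) (\<lambda>x. 1 + norm (g x))"
    using g_integrable finite_measure.integrable_const[OF finite_lborel_on, of "1::real"] by simp
  have "g \<in> borel_measurable (lborel_on \<Omega>)" using g_integrable by auto
  then show "(\<lambda>x. norm (1::real, g x)) \<in> borel_measurable (lborel_on \<Omega>)"
    by (intro measurable_compose[OF _ borel_measurable_norm] borel_measurable_Pair) auto
  show "AE x in lborel_on \<Omega>. norm (norm (1::real, g x)) \<le> norm (1 + norm (g x))"
  proof (rule AE_I2)
    fix x
    show "norm (norm (1::real, g x)) \<le> norm (1 + norm (g x))"
      using norm_Pair_le[of "1::real" "g x"] by simp
  qed
qed

lemma area_eq: "calV \<Omega> v = ennreal (\<integral>x. norm (\<tau> x, p x) \<partial>\<Lambda>)"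
proof -
  have "AE x in lebesgue. x \<in> \<Omega> \<longrightarrow>
      ennreal (sqrt (1 + (norm (approx_gradient \<Omega> v x))\<^sup>2)) = ennreal (norm (1::real, g x))"
    using g_gradient by eventually_elim (simp add: norm_one_Pair)
  then have "(\<integral>\<^sup>+x\<in>\<Omega>. ennreal (sqrt (1 + (norm (approx_gradient \<Omega> v x))\<^sup>2)) \<partial>lebesgue)
      = (\<integral>\<^sup>+x. ennreal (norm (1::real, g x)) \<partial>lborel_on \<Omega>)"
    by (rule nn_integral_lebesgue_lborel_on[OF \<Omega>_borel])
  also have "\<dots> = ennreal (\<integral>x. norm (1::real, g x) \<partial>lborel_on \<Omega>)"
    using norm_one_gradient_integrable by (intro nn_integral_eq_integral) auto
  finally have "calV \<Omega> v = ennreal ((\<integral>x. norm (1::real, g x) \<partial>lborel_on \<Omega>) + singular_mass)"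
    unfolding calV_def total_variation_singular by (simp add: ennreal_plus singular_mass_nonneg)
  also have "(\<integral>x. norm (1::real, g x) \<partial>lborel_on \<Omega>) + singular_mass = (\<integral>x. norm (\<tau> x, p x) \<partial>\<Lambda>)"
  proof (rule integral_split[symmetric, OF norm_one_gradient_integrable])
    show "(\<lambda>x. norm (\<tau> x, p x)) \<in> borel_measurable \<Lambda>"
      by (rule borel_measurable_integrable[OF integrable_norm[OF graph_integrable]])
    fix x
    show "norm (\<tau> x, p x) = norm (p x)" if "\<tau> x = 0" using that by (simp add: norm_Pair)
    assume "p x = \<tau> x *\<^sub>R g x"
    then have "(\<tau> x, p x) = \<tau> x *\<^sub>R (1, g x)" by simp
    then show "norm (\<tau> x, p x) = \<tau> x * norm (1::real, g x)"       using \<tau>_nonneg[of x] by (simp only: norm_scaleR abs_of_nonneg)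
  qed
  finally show ?thesis .
qed

lemma excess_eq:
  assumes G: "G \<in> Cc \<Omega>"
  shows "(\<integral>x. norm (p x - \<tau> x *\<^sub>R G x) \<partial>\<Lambda>)
    = (\<integral>x. norm (g x - G x) \<partial>lborel_on \<Omega>) + singular_mass"
proof (rule integral_split)
  show "integrable (lborel_on \<Omega>) (\<lambda>x. norm (g x - G x))"
    using g_integrable Cc_integrable[OF G finite_lborel_on sets_lborel_on] by simp
  have [measurable]: "G \<in> borel_measurable \<Lambda>" by (rule Cc_measurable[OF G sets_\<Lambda>])
  show "(\<lambda>x. norm (p x - \<tau> x *\<^sub>R G x)) \<in> borel_measurable \<Lambda>" by measurable
  fix x
  show "norm (p x - \<tau> x *\<^sub>R G x) = norm (p x)" if "\<tau> x = 0" using that by simp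
  assume "p x = \<tau> x *\<^sub>R g x"
  then have "p x - \<tau> x *\<^sub>R G x = \<tau> x *\<^sub>R (g x - G x)" by (simp add: scaleR_diff_right)
  then show "norm (p x - \<tau> x *\<^sub>R G x) = \<tau> x * norm (g x - G x)" using \<tau>_nonneg[of x] by simp
qed

text \<open>Written in this form, the pairing consists of a term independent of \<open>v\<close> and of the
  componentwise integrals to which weak-* convergence refers.\<close>

lemma pairing_eq:
  fixes W :: "real^'n \<Rightarrow> real \<times> (real^'n^'m)"
  assumes W: "W \<in> Cc \<Omega>"
  shows "(\<integral>x. W x \<bullet> (\<tau> x, p x) \<partial>\<Lambda>) = (\<integral>x. fst (W x) \<partial>lborel_on \<Omega>)
    + (\<Sum>b\<in>Basis. vector_integral (borel_on \<Omega>) (distr_deriv \<Omega> v) (\<lambda>x. snd (W x) \<bullet> b) \<bullet> b)"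
proof -
  have contW: "continuous_on UNIV W" by (rule Cc_continuous[OF W])
  have W1: "(\<lambda>x. fst (W x)) \<in> Cc \<Omega>" and W2: "(\<lambda>x. snd (W x)) \<in> Cc \<Omega>"
    by (rule Cc_support[OF W]; use contW in \<open>auto intro!: continuous_intros\<close>)+
  have f: "integrable (lborel_on \<Omega>) (\<lambda>x. fst (W x))"
    by (rule Cc_integrable[OF W1 finite_lborel_on sets_lborel_on])
  have comp: "vector_integral (borel_on \<Omega>) (distr_deriv \<Omega> v) (\<lambda>x. snd (W x) \<bullet> b) \<bullet> b
      = (\<integral>x. (snd (W x) \<bullet> b) * (p x \<bullet> b) \<partial>\<Lambda>)"
    and int: "integrable \<Lambda> (\<lambda>x. (snd (W x) \<bullet> b) * (p x \<bullet> b))" for b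
  proof -
    have Wb: "(\<lambda>x. snd (W x) \<bullet> b) \<in> Cc \<Omega>"
      by (rule Cc_support[OF W2]) (use Cc_continuous[OF W2] in \<open>auto intro!: continuous_intros\<close>)
    obtain C where C: "\<And>x. norm (snd (W x) \<bullet> b) \<le> C" using Cc_bounded[OF Wb] by blast
    have C': "\<bar>snd (W x) \<bullet> b\<bar> \<le> C" for x using C[of x] by simp
    have "vector_integral (borel_on \<Omega>) (distr_deriv \<Omega> v) (\<lambda>x. snd (W x) \<bullet> b)
        = (\<integral>x. (snd (W x) \<bullet> b) *\<^sub>R p x \<partial>\<Lambda>)"
      by (rule vector_integral_density[OF sets_\<Lambda> p_integrable derivative_density
            Cc_measurable[OF Wb sets_\<Lambda>] C'])
    moreover have "integrable \<Lambda> (\<lambda>x. (snd (W x) \<bullet> b) *\<^sub>R p x)"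
    proof (rule Bochner_Integration.integrable_bound)
      show "integrable \<Lambda> (\<lambda>x. C * norm (p x))" using p_integrable by simp
      show "(\<lambda>x. (snd (W x) \<bullet> b) *\<^sub>R p x) \<in> borel_measurable \<Lambda>"
        using Cc_measurable[OF Wb sets_\<Lambda>] by simp
      have "0 \<le> C" using C'[of undefined] by simp
      then show "AE x in \<Lambda>. norm ((snd (W x) \<bullet> b) *\<^sub>R p x) \<le> norm (C * norm (p x))"
        using C' by (auto simp: abs_mult intro!: mult_right_mono)
    qed
    then have "integrable \<Lambda> (\<lambda>x. ((snd (W x) \<bullet> b) *\<^sub>R p x) \<bullet> b)"
      "(\<integral>x. ((snd (W x) \<bullet> b) *\<^sub>R p x) \<bullet> b \<partial>\<Lambda>) = (\<integral>x. (snd (W x) \<bullet> b) *\<^sub>R p x \<partial>\<Lambda>) \<bullet> b"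
      by (rule integrable_inner_left, rule integral_inner_left)
    ultimately show "vector_integral (borel_on \<Omega>) (distr_deriv \<Omega> v) (\<lambda>x. snd (W x) \<bullet> b) \<bullet> b
        = (\<integral>x. (snd (W x) \<bullet> b) * (p x \<bullet> b) \<partial>\<Lambda>)"
      "integrable \<Lambda> (\<lambda>x. (snd (W x) \<bullet> b) * (p x \<bullet> b))" by simp_all
  qed
  have "(\<integral>x. W x \<bullet> (\<tau> x, p x) \<partial>\<Lambda>)
      = (\<integral>x. \<tau> x * fst (W x) + (\<Sum>b\<in>Basis. (snd (W x) \<bullet> b) * (p x \<bullet> b)) \<partial>\<Lambda>)"
  proof (intro Bochner_Integration.integral_cong refl)
    fix x
    have "W x \<bullet> (\<tau> x, p x) = fst (W x) * \<tau> x + snd (W x) \<bullet> p x" by (simp add: inner_prod_def)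
    also have "snd (W x) \<bullet> p x = (\<Sum>b\<in>Basis. (snd (W x) \<bullet> b) * (p x \<bullet> b))" by (rule euclidean_inner)
    finally show "W x \<bullet> (\<tau> x, p x) = \<tau> x * fst (W x) + (\<Sum>b\<in>Basis. (snd (W x) \<bullet> b) * (p x \<bullet> b))"
      by (simp only: mult.commute)
  qed
  also have "\<dots> = (\<integral>x. fst (W x) \<partial>lborel_on \<Omega>) + (\<Sum>b\<in>Basis. \<integral>x. (snd (W x) \<bullet> b) * (p x \<bullet> b) \<partial>\<Lambda>)"
    using integrable_lborel_on_density[OF f] int by simp
  finally show ?thesis by (simp add: comp)
qed

end

section \<open>Continuity along area-convergent sequences\<close>

theorem theorem3p2:
  fixes us :: "nat \<Rightarrow> real^'n \<Rightarrow> real^'m" and u :: "real^'n \<Rightarrow> real^'m"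
    and B :: "(real^'n) set"
  defines "B \<equiv> ball 0 1"
  assumes "CARD('n) \<ge> 2" and "CARD('m) \<ge> 2"
    and "\<And>h. us h \<in> BV B" and "u \<in> BV B"
    and "BV_weak_star B us u"
    and "(\<lambda>h. calV B (us h)) \<longlonglongrightarrow> calV B u"
  shows "((\<lambda>h. (\<integral>\<^sup>+x\<in>B. ennreal (norm (approx_gradient B (us h) x - approx_gradient B u x)) \<partial>lebesgue)
             + total_variation (borel_on B) (singular_part B (us h)) B)
          \<longlonglongrightarrow> total_variation (borel_on B) (singular_part B u) B)
        \<and> BV_strict B us u"
proof -
  have B: "open B" "bounded B" by (simp_all add: B_def)
  have "\<forall>h. \<exists>\<Lambda> \<tau> p g. graph_density B (us h) \<Lambda> \<tau> p g"
    using ex_graph_density[OF B assms(4)] by blast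
  then obtain \<Lambda> \<tau> p g where gd: "\<And>h. graph_density B (us h) (\<Lambda> h) (\<tau> h) (p h) (g h)"
    by metis
  obtain \<Lambda>0 \<tau>0 p0 g0 where gd0: "graph_density B u \<Lambda>0 \<tau>0 p0 g0"
    using ex_graph_density[OF B assms(5)] by blast
  interpret U: graph_density B u \<Lambda>0 \<tau>0 p0 g0 by (rule gd0)
  interpret H: graph_density B "us h" "\<Lambda> h" "\<tau> h" "p h" "g h" for h by (rule gd)
  let ?L = "lborel_on B"
  have weak: "(\<lambda>h. \<integral>x. W x \<bullet> (\<tau> h x, p h x) \<partial>\<Lambda> h) \<longlonglongrightarrow> (\<integral>x. W x \<bullet> (\<tau>0 x, p0 x) \<partial>\<Lambda>0)"
    if W: "W \<in> Cc B" for W :: "real^'n \<Rightarrow> real \<times> (real^'n^'m)"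
  proof -
    have "(\<lambda>x. snd (W x) \<bullet> b) \<in> C0 B" for b
      by (intro Cc_imp_C0 Cc_support[OF W])
        (use Cc_continuous[OF W] in \<open>auto intro!: continuous_intros\<close>)
    then show ?thesis
      using assms(6) unfolding H.pairing_eq[OF W] U.pairing_eq[OF W] BV_weak_star_def weak_star_measures_def
      by (intro tendsto_intros) auto
  qed
  have mass: "(\<lambda>h. \<integral>x. norm (\<tau> h x, p h x) \<partial>\<Lambda> h) \<longlonglongrightarrow> (\<integral>x. norm (\<tau>0 x, p0 x) \<partial>\<Lambda>0)"
    using assms(7) unfolding H.area_eq U.area_eq by (subst (asm) tendsto_ennreal_iff) auto
  have excess: "(\<lambda>h. \<integral>x. norm (p h x - \<tau> h x *\<^sub>R G x) \<partial>\<Lambda> h) \<longlonglongrightarrow> (\<integral>x. norm (p0 x - \<tau>0 x *\<^sub>R G x) \<partial>\<Lambda>0)"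
    if "G \<in> Cc B" for G
    using graph_excess_continuous[OF B(1) U.finite_\<Lambda> U.sets_\<Lambda> U.graph_integrable
        H.finite_\<Lambda> H.sets_\<Lambda> H.graph_integrable weak mass that] by simp
  have "(\<lambda>h. \<integral>x. norm (p h x) \<partial>\<Lambda> h) \<longlonglongrightarrow> (\<integral>x. norm (p0 x) \<partial>\<Lambda>0)"
    using excess[OF Cc_zero] by simp
  then have strict: "BV_strict B us u"
    using assms(6) unfolding BV_strict_def H.total_variation_derivative U.total_variation_derivative
    by (intro conjI tendsto_ennrealI)
  define X where "X h = (\<integral>x. norm (g h x - g0 x) \<partial>?L) + H.singular_mass h" for h
  \<comment> \<open>Replacing the gradient of \<open>u\<close> by a continuous \<open>G\<close> changes \<open>X h\<close> by at most \<open>d\<close>, uniformly in \<open>h\<close>.\<close>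
  have "X \<longlonglongrightarrow> U.singular_mass"
  proof (rule LIMSEQ_I)
    fix e :: real assume e: "e > 0"
    obtain G where G: "G \<in> Cc B" "(\<integral>x. norm (g0 x - G x) \<partial>?L) < e / 3"
      using Cc_dense[OF B(1) U.finite_lborel_on sets_lborel_on U.g_integrable, of "e / 3"] e by auto
    have intG: "integrable ?L G" by (rule Cc_integrable[OF G(1) U.finite_lborel_on sets_lborel_on])
    define d where "d = (\<integral>x. norm (g0 x - G x) \<partial>?L)"
    define Y where "Y h = (\<integral>x. norm (g h x - G x) \<partial>?L) + H.singular_mass h" for h
    have "Y \<longlonglongrightarrow> d + U.singular_mass"
      using excess[OF G(1)] unfolding H.excess_eq[OF G(1)] U.excess_eq[OF G(1)] Y_def d_def .
    then obtain n where n: "\<And>h. h \<ge> n \<Longrightarrow> norm (Y h - (d + U.singular_mass)) < e / 3"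
      using LIMSEQ_D[of Y _ "e / 3"] e by auto
    have XY: "\<bar>X h - Y h\<bar> \<le> d" for h
    proof -
      have "(\<integral>x. norm (g h x - g0 x) \<partial>?L) \<le> (\<integral>x. norm (g h x - G x) + norm (g0 x - G x) \<partial>?L)"
        using H.g_integrable[of h] U.g_integrable intG
        by (intro integral_mono) (auto intro: order_trans[OF _ norm_triangle_ineq4])
      moreover have "(\<integral>x. norm (g h x - G x) \<partial>?L) \<le> (\<integral>x. norm (g h x - g0 x) + norm (g0 x - G x) \<partial>?L)"
        using H.g_integrable[of h] U.g_integrable intG
        by (intro integral_mono) (auto intro: order_trans[OF _ norm_triangle_ineq])
      ultimately show ?thesis
        using H.g_integrable[of h] U.g_integrable intG unfolding X_def Y_def d_def by simp
    qed
    have "norm (X h - U.singular_mass) < e" if "h \<ge> n" for h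
      using n[OF that] XY[of h] G(2) unfolding d_def[symmetric] real_norm_def by linarith
    then show "\<exists>n. \<forall>h\<ge>n. norm (X h - U.singular_mass) < e" by blast
  qed
  moreover have "(\<integral>\<^sup>+x\<in>B. ennreal (norm (approx_gradient B (us h) x - approx_gradient B u x)) \<partial>lebesgue)
      + total_variation (borel_on B) (singular_part B (us h)) B = ennreal (X h)" for h
  proof -
    have "AE x in lebesgue. x \<in> B \<longrightarrow> ennreal (norm (approx_gradient B (us h) x - approx_gradient B u x))
        = ennreal (norm (g h x - g0 x))"
      using H.g_gradient[of h] U.g_gradient by eventually_elim simp
    then have "(\<integral>\<^sup>+x\<in>B. ennreal (norm (approx_gradient B (us h) x - approx_gradient B u x)) \<partial>lebesgue)
        = (\<integral>\<^sup>+x. ennreal (norm (g h x - g0 x)) \<partial>?L)"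
      by (rule nn_integral_lebesgue_lborel_on[OF U.\<Omega>_borel])
    also have "\<dots> = ennreal (\<integral>x. norm (g h x - g0 x) \<partial>?L)"
      using H.g_integrable[of h] U.g_integrable by (intro nn_integral_eq_integral) auto
    finally show ?thesis
      unfolding X_def H.total_variation_singular by (simp add: ennreal_plus H.singular_mass_nonneg)
  qed
  ultimately show ?thesis
    using strict unfolding U.total_variation_singular by (simp add: tendsto_ennrealI)
qed

end
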